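(* Let $(S,\preccurlyeq)$ be a preordered semiring of polynomial growth such that $\mathbb{N}\hookrightarrow S$ is an order embedding. Let $M\subseteq S$ and $T\subseteq S\setminus\{0\}$ be a multiplicative set containing $1$, and let $S_0$ be the subsemiring of $S$ generated by $M\cup T$. Suppose that (M1') for all $s\in S\setminus\{0\}$ there exist $m\in M$, $t_1,t_2\in T$ and $n\in\mathbb{N}$ such that $t_2\preccurlyeq n m t_1 s$ and $m t_1 s\preccurlyeq n t_2$; (M2') for all $m\in M$ and $t_1,t_2\in T$ such that $\operatorname{ev}_m\frac{\operatorname{ev}_{t_1}}{\operatorname{ev}_{t_2}}:\Delta(S_0,\preccurlyeq)\to\mathbb{R}_{\ge 0}$ is bounded, there is an $n\in\mathbb{N}$ such that $m t_1\preccurlyeq n t_2$. Then for every $x,y\in S$ we have $$x\succsim y\iff\forall f\in\Delta(S,\preccurlyeq):f(x)\ge f(y).$$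
   Context: A semiring is a set with commutative and associative operations $+$ and $\cdot$ with neutral elements $0$ and $1$ respectively, such that $0\cdot a=0$ and $a(b+c)=ab+ac$. Semiring homomorphisms preserve $0,1,+,\cdot$; a subsemiring contains $0$ and $1$. $\mathbb{N}=\{0,1,2,\ldots\}$, and $n\in\mathbb{N}$ also denotes its image $n\cdot 1$ in a semiring under the canonical map. A set $T\subseteq S\setminus\{0\}$ is multiplicative if $t_1,t_2\in T\implies t_1t_2\in T$. A preordered semiring is a pair $(S,\preccurlyeq)$ with $S$ a semiring and $\preccurlyeq$ a reflexive transitive relation on $S$ such that $0\preccurlyeq 1$ and $a\preccurlyeq b$ implies $a+c\preccurlyeq b+c$ and $ac\preccurlyeq bc$ for all $c\in S$. We write $b\succcurlyeq a$ for $a\preccurlyeq b$. The canonical map $\mathbb{N}\to S$ is an order embedding if $n\preccurlyeq m\iff n\le m$ for $n,m\in\mathbb{N}$. Subsemirings carry the restricted preorder, denoted by the same symbol. An element $u\in S$ is power universal if $u\succcurlyeq 1$ and for every $x\in S\setminus\{0\}$ there is a $k\in\mathbb{N}$ such that $x\preccurlyeq u^k$ and $u^kx\succcurlyeq 1$. $S$ is of polynomial growth if it has a power universal element. Asymptotic preorder: for $(S,\preccurlyeq)$ of polynomial growth and $u$ power universal, $x\succsim y$ iff there is a sequence $(k_n)_{n\in\mathbb{N}}$ of nonnegative integers with $\lim_{n\to\infty}k_n/n=0$ and $u^{k_n}x^n\succcurlyeq y^n$ for all $n\in\mathbb{N}$ (this relation does not depend on the choice of $u$). For a preordered semiring $(S,\preccurlyeq)$,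 the spectrum $\Delta(S,\preccurlyeq)$ is the set of semiring homomorphisms $f:S\to\mathbb{R}_{\ge 0}$ that are monotone ($x\preccurlyeq y\implies f(x)\le f(y)$). For $s\in S$, $\operatorname{ev}_s:\Delta(S,\preccurlyeq)\to\mathbb{R}_{\ge 0}$ denotes the evaluation map $f\mapsto f(s)$; the same notation is used for $S_0$ in place of $S$, so that $\operatorname{ev}_m\frac{\operatorname{ev}_{t_1}}{\operatorname{ev}_{t_2}}$ is the function $f\mapsto f(m)\frac{f(t_1)}{f(t_2)}$ on $\Delta(S_0,\preccurlyeq)$.
   Formalization: In (M2') the quotient is undefined at f with f(t_2)=0; "bounded" is read as bounded over those f in Δ(S_0) with f(t_2)≠0. If (M2') were required only when ev_{t_2} vanishes nowhere, the claim would be false. *)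

theory Defs
  imports "HOL-Analysis.Analysis"
begin

text \<open>
  The ambient commutative semiring is a type of class \<^class>\<open>comm_semiring_1\<close>. This class demands
  \<open>0 \<noteq> 1\<close>, which is no loss for preordered semirings in which the canonical map from the naturals
  is an order embedding.
\<close>

definition preordered_semiring :: "('a::comm_semiring_1 \<Rightarrow> 'a \<Rightarrow> bool) \<Rightarrow> bool" where
  "preordered_semiring le \<longleftrightarrow>
     reflp le \<and> transp le \<and> le 0 1 \<and>
     (\<forall>a b c. le a b \<longrightarrow> le (a + c) (b + c) \<and> le (a * c) (b * c))"

definition nat_order_embedding :: "('a::comm_semiring_1 \<Rightarrow> 'a \<Rightarrow> bool) \<Rightarrow> bool" where
  "nat_order_embedding le \<longleftrightarrow> (\<forall>n m :: nat. le (of_nat n) (of_nat m) \<longleftrightarrow> n \<le> m)"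

definition power_universal :: "('a::comm_semiring_1 \<Rightarrow> 'a \<Rightarrow> bool) \<Rightarrow> 'a \<Rightarrow> bool" where
  "power_universal le u \<longleftrightarrow>
     le 1 u \<and> (\<forall>x. x \<noteq> 0 \<longrightarrow> (\<exists>k::nat. le x (u ^ k) \<and> le 1 (u ^ k * x)))"

definition polynomial_growth :: "('a::comm_semiring_1 \<Rightarrow> 'a \<Rightarrow> bool) \<Rightarrow> bool" where
  "polynomial_growth le \<longleftrightarrow> (\<exists>u. power_universal le u)"

text \<open>
  The asymptotic preorder is independent of the power universal element used to define it; here
  that element is an explicit parameter. The relation reads: \<open>x\<close> is asymptotically at least \<open>y\<close>.
\<close>

definition asymptotically_ge ::
  "('a::comm_semiring_1 \<Rightarrow> 'a \<Rightarrow> bool) \<Rightarrow> 'a \<Rightarrow> 'a \<Rightarrow> 'a \<Rightarrow> bool" where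
  "asymptotically_ge le u x y \<longleftrightarrow>
     (\<exists>k :: nat \<Rightarrow> nat. (\<lambda>n. real (k n) / real n) \<longlonglongrightarrow> 0 \<and>
        (\<forall>n. le (y ^ n) (u ^ k n * x ^ n)))"

definition multiplicative_set :: "'a::comm_semiring_1 set \<Rightarrow> bool" where
  "multiplicative_set T \<longleftrightarrow> 0 \<notin> T \<and> (\<forall>t1\<in>T. \<forall>t2\<in>T. t1 * t2 \<in> T)"

definition subsemiring :: "'a::comm_semiring_1 set \<Rightarrow> bool" where
  "subsemiring A \<longleftrightarrow> 0 \<in> A \<and> 1 \<in> A \<and> (\<forall>a\<in>A. \<forall>b\<in>A. a + b \<in> A \<and> a * b \<in> A)"

definition generated_subsemiring :: "'a::comm_semiring_1 set \<Rightarrow> 'a set" where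
  "generated_subsemiring X = subsemiring hull X"

text \<open>
  The spectrum of a subsemiring \<open>A\<close> with the restricted preorder. Its elements are maps defined on
  \<open>A\<close> only, represented by functions that are \<^const>\<open>undefined\<close> outside \<open>A\<close>.
\<close>

definition spectrum ::
  "'a::comm_semiring_1 set \<Rightarrow> ('a \<Rightarrow> 'a \<Rightarrow> bool) \<Rightarrow> ('a \<Rightarrow> real) set" where
  "spectrum A le =
     {f \<in> A \<rightarrow>\<^sub>E {0..}. f 0 = 0 \<and> f 1 = 1 \<and>
        (\<forall>x\<in>A. \<forall>y\<in>A. f (x + y) = f x + f y \<and> f (x * y) = f x * f y) \<and>
        (\<forall>x\<in>A. \<forall>y\<in>A. le x y \<longrightarrow> f x \<le> f y)}"

text \<open>
  A monotone homomorphism on the generated subsemiring may vanish at a nonzero \<open>t2\<close>. At such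
  points the quotient below is \<open>0\<close>, so it is bounded on a set of homomorphisms iff it is bounded
  on those with \<open>f t2 \<noteq> 0\<close>, that is, where it is mathematically defined.
\<close>

definition ev_ratio :: "'a \<Rightarrow> 'a \<Rightarrow> 'a \<Rightarrow> ('a \<Rightarrow> real) \<Rightarrow> real" where
  "ev_ratio m t1 t2 f = f m * (f t1 / f t2)"

end

theory Submission imports Defs begin

text \<open>
  A monotone homomorphism \<open>f\<close> turns \<open>y ^ n \<preceq> u ^ k * x ^ n\<close> with \<open>k = o(n)\<close> into \<open>f y \<le> f x\<close>, by taking
  \<open>n\<close>-th roots. The content of the theorem is the converse, a Positivstellensatz: if the
  strict opposite of the claimed inequality is forced into the preorder, no point of the spectrum
  survives; a preorder without spectral points is degenerate, and the degeneracy, unfolded in terms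
  of the original preorder, is the claimed inequality.

  Points of the spectrum come from one extension result, \<open>spectrum_extension\<close>: a monotone
  homomorphism \<open>f\<close> on a subsemiring \<open>A\<close> extends to the whole semiring as soon as every nonzero
  element is bounded above and below, up to factors on which \<open>f\<close> is positive, by elements of \<open>A\<close>.
  By Zorn's lemma there is a maximal preorder for which \<open>f\<close> is still monotone. Maximality makes
  it agree with the values of \<open>f\<close> on \<open>A\<close> and makes it total, and a total preorder whose nonzero
  elements lie between positive rationals defines a homomorphism by Dedekind cuts. For the image
  of the natural numbers this says
  that a preordered semiring in which every nonzero element lies between two positive rationals
  has a nonempty spectrum, as long as no \<open>n + 1\<close> is below \<open>n\<close>.

  Write \<open>a \<sim> b\<close> if each of \<open>a\<close>, \<open>b\<close> is below a natural multiple of the other. The first hypothesis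
  on \<open>M\<close> and \<open>T\<close> provides inverses up to \<open>\<sim>\<close>, and used repeatedly it shows that every quotient \<open>y / x\<close>
  of nonzero elements satisfies \<open>t2 * y \<sim> m * t1 * x\<close> for some \<open>m\<close>, \<open>t1\<close>, \<open>t2\<close>. Together with the extension result
  the second hypothesis becomes a statement about the spectrum of the whole semiring
  (\<open>le_multiple_if_spectrum_le\<close>): if \<open>f y \<le> f x\<close> for all \<open>f\<close>, then \<open>c * y \<preceq> n * x * c\<close> for some
  nonzero \<open>c\<close> and some natural number \<open>n\<close>. This is the crude bound that rules out
  behaviour at infinity, because it makes the following preorders bounded. In the same way one sees that the
  spectrum is not empty (\<open>spectrum_nonempty\<close>), which settles the case \<open>x = 0\<close>.

  Given nonzero \<open>x\<close>, \<open>y\<close> with \<open>f y \<le> f x\<close> for all \<open>f\<close>, fix \<open>N\<close> and adjoin the relation \<open>X \<preceq> Y\<close> for \<open>X = u * x ^ N\<close> and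
  \<open>Y = y ^ N\<close>, together with cancellation of nonzero factors. By the crude bound \<open>u\<close> is below a
  natural number in the new preorder, so all elements are bounded. A point of its spectrum
  would satisfy \<open>f u * f x ^ N \<le> f y ^ N \<le> f x ^ N\<close>, that is \<open>f u \<le> 1\<close>, whereas \<open>2 \<preceq> u ^ a\<close> for
  some \<open>a\<close>. Hence the spectrum is empty, and the new preorder puts some \<open>n + 1\<close> below \<open>n\<close>.
  Unfolded, this is an inequality \<open>d * (n + 1) + s * Y \<preceq> d * n + s * X\<close> in the old preorder. A
  telescoping geometric sum and the crude bound once more turn it into
  \<open>w * y ^ (N * K) \<preceq> w * u ^ (2 * K) * x ^ (N * K)\<close> for some \<open>w \<noteq> 0\<close> and \<open>K > 0\<close>
  (\<open>single_power_bound\<close>). The exponent of \<open>u\<close> per factor of \<open>x\<close> is \<open>2 / N\<close>, and \<open>N\<close> is arbitrary.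
\<close>

section \<open>Preordered semirings\<close>

locale preordered =
  fixes le :: "'a::comm_semiring_1 \<Rightarrow> 'a \<Rightarrow> bool"  (infix "\<preceq>" 50)
  assumes preordered: "preordered_semiring (\<preceq>)"
begin

lemma le_refl [simp]: "a \<preceq> a"
  using preordered by (auto simp: preordered_semiring_def reflp_def)

lemma le_trans [trans]: "a \<preceq> b \<Longrightarrow> b \<preceq> c \<Longrightarrow> a \<preceq> c"
  using preordered unfolding preordered_semiring_def transp_def by blast

lemma zero_le_one: "0 \<preceq> 1"
  using preordered by (simp add: preordered_semiring_def)

lemma add_right: "a \<preceq> b \<Longrightarrow> a + c \<preceq> b + c"
  and mult_right: "a \<preceq> b \<Longrightarrow> a * c \<preceq> b * c"
  using preordered by (auto simp: preordered_semiring_def)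

lemma add_left: "a \<preceq> b \<Longrightarrow> c + a \<preceq> c + b"
  and mult_left: "a \<preceq> b \<Longrightarrow> c * a \<preceq> c * b"
  using add_right[of a b c] mult_right[of a b c] by (simp_all add: add.commute mult.commute)

lemma add_le_add: "a \<preceq> b \<Longrightarrow> c \<preceq> d \<Longrightarrow> a + c \<preceq> b + d"
  using add_right add_left le_trans by blast

lemma mult_le_mult: "a \<preceq> b \<Longrightarrow> c \<preceq> d \<Longrightarrow> a * c \<preceq> b * d"
  using mult_right mult_left le_trans by blast

lemma zero_le [simp]: "0 \<preceq> a"
  using mult_right[OF zero_le_one, of a] by simp

lemma le_add1: "a \<preceq> a + b"
  using add_left[of 0 b a] by simp

lemma le_add2: "a \<preceq> b + a"
  using add_right[of 0 b a] by simp

lemma power_le_power: "a \<preceq> b \<Longrightarrow> a ^ k \<preceq> b ^ k"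
  by (induction k) (auto intro: mult_le_mult)

lemma of_nat_le: "n \<le> m \<Longrightarrow> of_nat n \<preceq> of_nat m"
  using le_add1[of "of_nat n" "of_nat (m - n)"] by (simp flip: of_nat_add)

lemma power_increasing: "1 \<preceq> a \<Longrightarrow> n \<le> m \<Longrightarrow> a ^ n \<preceq> a ^ m"
  using mult_left[OF power_le_power[of 1 a "m - n"], of "a ^ n"]
  by (simp flip: power_add)

text \<open>
  An inequality that holds after multiplication by \<open>c\<close> can be raised to any power with \<open>c\<close> still
  occurring only once on each side.
\<close>

lemma mult_power_le:
  assumes "c * a \<preceq> b * c"
  shows "c * a ^ k \<preceq> b ^ k * c"
proof (induction k)
  case (Suc k)
  have "c * a ^ Suc k = (c * a) * a ^ k" by (simp add: mult_ac)
  also have "\<dots> \<preceq> (b * c) * a ^ k" by (rule mult_right[OF assms])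
  also have "\<dots> = b * (c * a ^ k)" by (simp add: mult_ac)
  also have "\<dots> \<preceq> b * (b ^ k * c)" by (rule mult_left[OF Suc.IH])
  finally show ?case by (simp add: mult_ac)
qed simp

lemma cancel_iterate:
  assumes "a + w \<preceq> w"
  shows "of_nat k * a + w \<preceq> w"
proof (induction k)
  case (Suc k)
  have "of_nat (Suc k) * a + w = of_nat k * a + (a + w)" by (simp add: algebra_simps)
  also have "\<dots> \<preceq> of_nat k * a + w" by (rule add_left[OF assms])
  also note Suc.IH
  finally show ?case .
qed simp

end

text \<open>
  The preorder obtained from \<open>le\<close> by forcing \<open>X\<close> to lie below \<open>Y\<close>. It says that \<open>d * (b - a)\<close> is
  at least \<open>s * (Y - X)\<close>, rearranged so that no subtraction occurs; such inequalities can be added,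
  so no transitive closure is needed. The factor \<open>d\<close> in addition cancels the elements of \<open>D\<close>; with
  \<open>D = {1}\<close> nothing is cancelled.
\<close>

definition adjoin where
  "adjoin D le X Y a b \<longleftrightarrow> (\<exists>s. \<exists>d\<in>D. le (d * a + s * Y) (d * b + s * X))"

lemma (in preordered) adjoin_preordered:
  assumes "1 \<in> D" "\<And>d e. d \<in> D \<Longrightarrow> e \<in> D \<Longrightarrow> d * e \<in> D"
  shows "preordered_semiring (adjoin D (\<preceq>) X Y)"
proof -
  let ?L = "adjoin D (\<preceq>) X Y"
  have base: "?L a b" if "a \<preceq> b" for a b
    unfolding adjoin_def using that assms(1) by (intro exI[of _ 0] bexI[of _ 1]) auto
  have trans: "?L a c" if ab: "?L a b" and bc: "?L b c" for a b c
  proof -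
    from ab obtain s d where d: "d \<in> D" "d * a + s * Y \<preceq> d * b + s * X"
      unfolding adjoin_def by blast
    from bc obtain r e where e: "e \<in> D" "e * b + r * Y \<preceq> e * c + r * X"
      unfolding adjoin_def by blast
    have "(d * e) * a + (e * s + d * r) * Y = e * (d * a + s * Y) + d * r * Y"
      by (simp add: algebra_simps)
    also have "\<dots> \<preceq> e * (d * b + s * X) + d * r * Y"
      by (rule add_right[OF mult_left[OF d(2)]])
    also have "\<dots> = d * (e * b + r * Y) + e * s * X"
      by (simp add: algebra_simps)
    also have "\<dots> \<preceq> d * (e * c + r * X) + e * s * X"
      by (rule add_right[OF mult_left[OF e(2)]])
    also have "\<dots> = (d * e) * c + (e * s + d * r) * X"
      by (simp add: algebra_simps)
    finally show ?thesis
      unfolding adjoin_def using assms(2)[OF d(1) e(1)] by blast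
  qed
  have add: "?L (a + c) (b + c)" if "?L a b" for a b c
  proof -
    from that obtain s d where d: "d \<in> D" "d * a + s * Y \<preceq> d * b + s * X"
      unfolding adjoin_def by blast
    have "d * (a + c) + s * Y \<preceq> d * (b + c) + s * X"
      using add_right[OF d(2), of "d * c"] by (simp add: algebra_simps)
    with d(1) show ?thesis unfolding adjoin_def by blast
  qed
  have mult: "?L (a * c) (b * c)" if "?L a b" for a b c
  proof -
    from that obtain s d where d: "d \<in> D" "d * a + s * Y \<preceq> d * b + s * X"
      unfolding adjoin_def by blast
    have "d * (a * c) + (s * c) * Y \<preceq> d * (b * c) + (s * c) * X"
      using mult_right[OF d(2), of c] by (simp add: algebra_simps)
    with d(1) show ?thesis unfolding adjoin_def by blast
  qed
  show ?thesis
    unfolding preordered_semiring_def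
    using base trans add mult zero_le_one by (auto simp: reflp_def intro: transpI)
qed

lemma (in preordered) adjoin_base:
  "1 \<in> D \<Longrightarrow> a \<preceq> b \<Longrightarrow> adjoin D (\<preceq>) X Y a b"
  unfolding adjoin_def by (intro exI[of _ 0] bexI[of _ 1]) auto

lemma (in preordered) adjoin_new:
  "1 \<in> D \<Longrightarrow> adjoin D (\<preceq>) X Y X Y"
  unfolding adjoin_def by (intro exI[of _ 1] bexI[of _ 1]) (auto simp: add.commute)

text \<open>
  The geometric sum \<open>\<Sum>i<k. a ^ i * b ^ (k - 1 - i)\<close>, which plays the role of the quotient
  \<open>(b ^ k - a ^ k) / (b - a)\<close> where there is no subtraction. The recursion avoids the truncated
  exponent.
\<close>

primrec geo :: "'a::comm_semiring_1 \<Rightarrow> 'a \<Rightarrow> nat \<Rightarrow> 'a" where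
  "geo a b 0 = 0"
| "geo a b (Suc k) = geo a b k * b + a ^ k"

text \<open>
  The hypothesis says that \<open>p - q \<le> s * (X - Y)\<close>; multiplying by the geometric sum gives
  \<open>(p - q) * geo X Y k \<le> s * (X ^ k - Y ^ k)\<close>. The induction arranges the telescoping so that
  nothing has to be cancelled: passing from \<open>k\<close> to \<open>k + 1\<close> uses the hypothesis multiplied by \<open>X ^ k\<close>.
\<close>

lemma (in preordered) geo_telescope:
  assumes "p + s * Y \<preceq> q + s * X"
  shows "p * geo X Y k + s * Y ^ k \<preceq> q * geo X Y k + s * X ^ k"
proof (induction k)
  case (Suc k)
  have "p * geo X Y (Suc k) + s * Y ^ Suc k = (p * geo X Y k + s * Y ^ k) * Y + p * X ^ k"
    by (simp add: algebra_simps)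
  also have "\<dots> \<preceq> (q * geo X Y k + s * X ^ k) * Y + p * X ^ k"
    by (rule add_right[OF mult_right[OF Suc.IH]])
  also have "\<dots> = q * geo X Y k * Y + (p + s * Y) * X ^ k"
    by (simp add: algebra_simps)
  also have "\<dots> \<preceq> q * geo X Y k * Y + (q + s * X) * X ^ k"
    by (rule add_left[OF mult_right[OF assms]])
  also have "\<dots> = q * geo X Y (Suc k) + s * X ^ Suc k"
    by (simp add: algebra_simps)
  finally show ?case .
qed simp

text \<open>
  Each of the \<open>k\<close> terms is at least \<open>\<alpha> ^ (k - 1)\<close>; the extra factor \<open>\<alpha>\<close> avoids this exponent.
\<close>

lemma geo_ge:
  fixes \<alpha> \<beta> :: real
  assumes "0 \<le> \<alpha>" "\<alpha> \<le> \<beta>"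
  shows "real k * \<alpha> ^ k \<le> \<alpha> * geo \<alpha> \<beta> k"
proof (induction k)
  case (Suc k)
  have g: "0 \<le> geo \<alpha> \<beta> k" using assms by (induction k) auto
  have "real (Suc k) * \<alpha> ^ Suc k = (real k * \<alpha> ^ k) * \<alpha> + \<alpha> * \<alpha> ^ k"
    by (simp add: algebra_simps)
  also have "\<dots> \<le> (\<alpha> * geo \<alpha> \<beta> k) * \<beta> + \<alpha> * \<alpha> ^ k"
    using mult_mono[OF Suc.IH assms(2)] g assms by simp
  finally show ?case by (simp add: algebra_simps)
qed simp

section \<open>Evaluation of homomorphisms\<close>

lemma spectrumD:
  assumes "f \<in> spectrum A le"
  shows "f 0 = 0" "f 1 = 1"
    "\<And>a. a \<in> A \<Longrightarrow> 0 \<le> f a"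
    "\<And>a b. a \<in> A \<Longrightarrow> b \<in> A \<Longrightarrow> f (a + b) = f a + f b"
    "\<And>a b. a \<in> A \<Longrightarrow> b \<in> A \<Longrightarrow> f (a * b) = f a * f b"
    "\<And>a b. a \<in> A \<Longrightarrow> b \<in> A \<Longrightarrow> le a b \<Longrightarrow> f a \<le> f b"
  using assms unfolding spectrum_def by (auto simp: PiE_def Pi_def)

lemma subsemiring_power: "subsemiring A \<Longrightarrow> a \<in> A \<Longrightarrow> a ^ k \<in> A"
  by (induction k) (auto simp: subsemiring_def)

lemma subsemiring_of_nat: "subsemiring A \<Longrightarrow> of_nat k \<in> A"
  by (induction k) (auto simp: subsemiring_def)

lemma subsemiring_geo: "subsemiring A \<Longrightarrow> a \<in> A \<Longrightarrow> b \<in> A \<Longrightarrow> geo a b k \<in> A"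
  by (induction k) (auto simp: subsemiring_def subsemiring_power)

lemma spectrum_power:
  assumes "subsemiring A" "f \<in> spectrum A le" "a \<in> A"
  shows "f (a ^ k) = f a ^ k"
  using assms by (induction k) (auto simp: spectrumD[OF assms(2)] subsemiring_power)

lemma spectrum_of_nat:
  assumes "subsemiring A" "f \<in> spectrum A le"
  shows "f (of_nat k) = real k"
proof (induction k)
  case (Suc k)
  have "f (of_nat (Suc k)) = f (1 + of_nat k)" by simp
  also have "\<dots> = f 1 + f (of_nat k)"
    using assms subsemiring_of_nat[of A k] by (intro spectrumD(4)) (auto simp: subsemiring_def)
  finally show ?case using Suc spectrumD(2)[OF assms(2)] by simp
qed (simp add: spectrumD[OF assms(2)])

lemma spectrum_geo:
  assumes "subsemiring A" "f \<in> spectrum A le" "a \<in> A" "b \<in> A"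
  shows "f (geo a b k) = geo (f a) (f b) k"
proof (induction k)
  case (Suc k)
  have "geo a b k * b \<in> A"
    using assms subsemiring_geo[of A a b k] by (auto simp: subsemiring_def)
  then show ?case
    using Suc assms spectrumD[OF assms(2)] subsemiring_geo[of A a b k] subsemiring_power[of A a k]
      spectrum_power[of A f le a k] by simp
qed (simp add: spectrumD[OF assms(2)])

section \<open>Maximal preorders and extension of homomorphisms\<close>

text \<open>
  All conditions on the preorder are inherited by unions of chains: each of them involves at most
  two related pairs at a time, and two members of a chain are comparable.
\<close>

lemma maximal_spectrum_preorder:
  fixes le :: "'a::comm_semiring_1 \<Rightarrow> 'a \<Rightarrow> bool"
  assumes "preordered_semiring le" "f \<in> spectrum A le"
  obtains P where "preordered_semiring P" "f \<in> spectrum A P" "le \<le> P"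
    "\<forall>Q. preordered_semiring Q \<longrightarrow> f \<in> spectrum A Q \<longrightarrow> P \<le> Q \<longrightarrow> Q \<le> P"
proof -
  let ?rel = "\<lambda>R a b. (a, b) \<in> (R :: ('a \<times> 'a) set)"
  define \<R> where "\<R> = {R. (\<forall>a b. le a b \<longrightarrow> ?rel R a b) \<and> preordered_semiring (?rel R)
    \<and> f \<in> spectrum A (?rel R)}"
  have "{(a, b). le a b} \<in> \<R>"
    using assms by (simp add: \<R>_def)
  then have ne: "\<R> \<noteq> {}" by blast
  have "\<Union>C \<in> \<R>" if C: "C \<noteq> {}" "subset.chain \<R> C" for C
  proof -
    have sub: "R \<in> \<R>" if "R \<in> C" for R
      using C(2) that by (auto simp: subset.chain_def)
    have cmp: "R \<subseteq> S \<or> S \<subseteq> R" if "R \<in> C" "S \<in> C" for R S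
      using C(2) that by (auto simp: subset.chain_def)
    obtain R0 where R0: "R0 \<in> C" using C(1) by blast
    have "?rel (\<Union>C) a b" if "le a b" for a b
      using that sub[OF R0] R0 by (auto simp: \<R>_def)
    moreover have "preordered_semiring (?rel (\<Union>C))"
      unfolding preordered_semiring_def
    proof (intro conjI allI impI)
      show "reflp (?rel (\<Union>C))"
        using sub[OF R0] R0 by (auto simp: \<R>_def preordered_semiring_def reflp_def)
      show "transp (?rel (\<Union>C))"
      proof (rule transpI)
        fix a b c assume "(a, b) \<in> \<Union>C" "(b, c) \<in> \<Union>C"
        then obtain R S where RS: "R \<in> C" "S \<in> C" "(a, b) \<in> R" "(b, c) \<in> S" by blast
        have T: "(a, c) \<in> T" if "T \<in> C" "R \<subseteq> T" "S \<subseteq> T" for T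
        proof -
          have "transp (?rel T)"
            using sub[OF that(1)] by (simp add: \<R>_def preordered_semiring_def)
          moreover have "(a, b) \<in> T" "(b, c) \<in> T" using RS that by auto
          ultimately show ?thesis by (rule transpD)
        qed
        show "(a, c) \<in> \<Union>C"
          using cmp[OF RS(1,2)] T[OF RS(1)] T[OF RS(2)] RS(1,2) by blast
      qed
      show "(0, 1) \<in> \<Union>C"
        using sub[OF R0] R0 by (auto simp: \<R>_def preordered_semiring_def)
    next
      fix a b c assume "(a, b) \<in> \<Union>C"
      then obtain R where R: "R \<in> C" "(a, b) \<in> R" by blast
      then have "(a + c, b + c) \<in> R" "(a * c, b * c) \<in> R"
        using sub[OF R(1)] by (auto simp: \<R>_def preordered_semiring_def)
      with R(1) show "(a + c, b + c) \<in> \<Union>C" "(a * c, b * c) \<in> \<Union>C" by blast+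
    qed
    moreover have "f \<in> spectrum A (?rel (\<Union>C))"
    proof -
      have "f a \<le> f b" if "a \<in> A" "b \<in> A" "(a, b) \<in> \<Union>C" for a b
        using that sub by (fastforce simp: \<R>_def spectrum_def)
      then show ?thesis using sub[OF R0] by (simp add: \<R>_def spectrum_def)
    qed
    ultimately show ?thesis by (simp add: \<R>_def)
  qed
  from subset_Zorn_nonempty[OF ne this] obtain R
    where R: "R \<in> \<R>" and max: "\<And>S. S \<in> \<R> \<Longrightarrow> R \<subseteq> S \<Longrightarrow> S = R" by blast
  show thesis
  proof (rule that[of "?rel R"])
    show "\<forall>Q. preordered_semiring Q \<longrightarrow> f \<in> spectrum A Q \<longrightarrow> ?rel R \<le> Q \<longrightarrow> Q \<le> ?rel R"
    proof (intro allI impI)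
      fix Q assume Q: "preordered_semiring Q" "f \<in> spectrum A Q" "?rel R \<le> Q"
      then have "{(a, b). Q a b} = R"
        using R by (intro max) (auto simp: \<R>_def)
      then show "Q \<le> ?rel R" by auto
    qed
  qed (use R in \<open>auto simp: \<R>_def\<close>)
qed

lemma zero_if_multiples_bounded:
  fixes d C :: real
  assumes "\<And>k::nat. k > 0 \<Longrightarrow> real k * \<bar>d\<bar> \<le> C"
  shows "d = 0"
proof (rule ccontr)
  assume "d \<noteq> 0"
  then obtain k :: nat where k: "C < real k * \<bar>d\<bar>"
    using reals_Archimedean3[of "\<bar>d\<bar>"] by auto
  have "real k * \<bar>d\<bar> \<le> real (Suc k) * \<bar>d\<bar>" by (intro mult_right_mono) auto
  with k assms[of "Suc k"] show False by simp
qed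

text \<open>
  The situation after the use of Zorn's lemma. The bounds by elements of \<open>A\<close> serve to turn
  inequalities with arbitrary coefficients into inequalities within \<open>A\<close>, where \<open>f\<close> can be evaluated.
\<close>

locale maximal_preorder = preordered P
  for P :: "'a::comm_semiring_1 \<Rightarrow> 'a \<Rightarrow> bool" (infix "\<preceq>" 50) +
  fixes A :: "'a set" and f :: "'a \<Rightarrow> real"
  assumes sub: "subsemiring A"
    and f: "f \<in> spectrum A P"
    and upper: "\<And>s. \<exists>p\<in>A. \<exists>q\<in>A. f p > 0 \<and> p * s \<preceq> q"
    and lower: "\<And>s. s \<noteq> 0 \<Longrightarrow> \<exists>p\<in>A. \<exists>q\<in>A. f p > 0 \<and> p \<preceq> q * s"
    and maximal: "\<And>Q a b. preordered_semiring Q \<Longrightarrow> f \<in> spectrum A Q \<Longrightarrow>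
      (\<And>a b. a \<preceq> b \<Longrightarrow> Q a b) \<Longrightarrow> Q a b \<Longrightarrow> a \<preceq> b"
begin

lemmas f_nonneg = spectrumD(3)[OF f]
lemmas f_mono = spectrumD(6)[OF f]
lemmas f_hom = spectrumD(1,2,4,5)[OF f] spectrum_power[OF sub f] spectrum_of_nat[OF sub f]
  spectrum_geo[OF sub f]
lemma A_closed [simp]: "0 \<in> A" "1 \<in> A" "a \<in> A \<Longrightarrow> b \<in> A \<Longrightarrow> a + b \<in> A"
  "a \<in> A \<Longrightarrow> b \<in> A \<Longrightarrow> a * b \<in> A" "a \<in> A \<Longrightarrow> a ^ k \<in> A" "of_nat k \<in> A"
  "a \<in> A \<Longrightarrow> b \<in> A \<Longrightarrow> geo a b k \<in> A"
  using sub by (auto simp: subsemiring_def subsemiring_power subsemiring_of_nat subsemiring_geo)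

text \<open>
  If \<open>a\<close> is not below \<open>b\<close>, maximality prevents \<open>f\<close> from being monotone once \<open>a \<preceq> b\<close> is
  adjoined. The two elements of \<open>A\<close> at which monotonicity fails are the witnesses.
\<close>

lemma not_le_witness:
  assumes "\<not> a \<preceq> b"
  obtains p q s where "p \<in> A" "q \<in> A" "f q < f p" "p + s * b \<preceq> q + s * a"
proof -
  have "f \<notin> spectrum A (adjoin {1} (\<preceq>) a b)"
  proof
    assume "f \<in> spectrum A (adjoin {1} (\<preceq>) a b)"
    with assms show False
      using maximal[of "adjoin {1} (\<preceq>) a b" a b] adjoin_preordered[of "{1}" a b]
        adjoin_base[of "{1}" _ _ a b] adjoin_new[of "{1}" a b] by auto
  qed
  then obtain p q where "p \<in> A" "q \<in> A" "\<not> f p \<le> f q" "adjoin {1} (\<preceq>) a b p q"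
    using f unfolding spectrum_def by auto
  with that show thesis unfolding adjoin_def by auto
qed

text \<open>
  Suppose \<open>f a \<le> f b\<close> but \<open>a \<preceq> b\<close> fails. The witnesses give \<open>(p - q) \<le> s * (a - b)\<close> with
  \<open>f p > f q\<close>. After multiplication by the geometric sum and replacement of \<open>s\<close> by an upper bound from
  \<open>A\<close>, the homomorphism \<open>f\<close> applies and yields \<open>\<delta> * geo (f a) (f b) k \<le> f w * f a ^ k\<close> with a
  fixed \<open>\<delta> > 0\<close>. But the sum has \<open>k\<close> terms, each at least \<open>f a ^ (k - 1)\<close>, which is
  a contradiction for large \<open>k\<close>, or for \<open>k = 1\<close> if \<open>f a = 0\<close>.
\<close>

lemma le_iff_on_subsemiring:
  assumes ab: "a \<in> A" "b \<in> A"
  shows "a \<preceq> b \<longleftrightarrow> f a \<le> f b"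
proof
  assume le: "f a \<le> f b"
  show "a \<preceq> b"
  proof (rule ccontr)
    assume "\<not> a \<preceq> b"
    then obtain p q s where pq: "p \<in> A" "q \<in> A" "f q < f p" "p + s * b \<preceq> q + s * a"
      by (rule not_le_witness)
    obtain v w where vw: "v \<in> A" "w \<in> A" "f v > 0" "v * s \<preceq> w"
      using upper by blast
    define \<delta> where "\<delta> = f v * (f p - f q)"
    have \<delta>: "\<delta> > 0" using pq vw by (simp add: \<delta>_def)
    have main: "\<delta> * geo (f a) (f b) k \<le> f w * f a ^ k" for k
    proof -
      let ?G = "geo a b k"
      have "p * ?G \<preceq> p * ?G + s * b ^ k" by (rule le_add1)
      also have "\<dots> \<preceq> q * ?G + s * a ^ k" by (rule geo_telescope[OF pq(4)])
      finally have "v * (p * ?G) \<preceq> v * (q * ?G + s * a ^ k)" by (rule mult_left)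
      also have "\<dots> = v * q * ?G + (v * s) * a ^ k" by (simp add: algebra_simps)
      also have "\<dots> \<preceq> v * q * ?G + w * a ^ k" by (rule add_left[OF mult_right[OF vw(4)]])
      finally have "f (v * (p * ?G)) \<le> f (v * q * ?G + w * a ^ k)"
        using pq vw ab by (intro f_mono) auto
      then show ?thesis
        using pq vw ab by (simp add: f_hom \<delta>_def algebra_simps)
    qed
    have a0: "f a \<ge> 0" using ab f_nonneg by auto
    show False
    proof (cases "f a = 0")
      case True
      with main[of 1] \<delta> show False by simp
    next
      case False
      have "real k * \<bar>\<delta>\<bar> \<le> f w * f a" for k
      proof -
        have "(real k * \<delta>) * f a ^ k = \<delta> * (real k * f a ^ k)" by simp
        also have "\<dots> \<le> \<delta> * (f a * geo (f a) (f b) k)"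
          using \<delta> geo_ge[OF a0 le] by (intro mult_left_mono) auto
        also have "\<dots> = f a * (\<delta> * geo (f a) (f b) k)" by simp
        also have "\<dots> \<le> f a * (f w * f a ^ k)"
          using main a0 by (intro mult_left_mono) auto
        also have "\<dots> = (f w * f a) * f a ^ k" by simp
        finally show ?thesis using \<delta> a0 False by (simp del: mult_Suc_right)
      qed
      then have "\<delta> = 0" using zero_if_multiples_bounded by blast
      with \<delta> show False by simp
    qed
  qed
qed (use f_mono ab in auto)

text \<open>
  Elements of \<open>A\<close> are now compared by their values, so bounds by elements of \<open>A\<close> improve to
  bounds by numbers.
\<close>

lemma nat_upper: "\<exists>n::nat. s \<preceq> of_nat n"
proof -
  obtain p q where pq: "p \<in> A" "q \<in> A" "f p > 0" "p * s \<preceq> q" using upper by blast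
  obtain m where m: "1 \<le> real m * f p"
    using reals_Archimedean3[OF pq(3)] less_imp_le by blast
  obtain n where n: "real m * f q \<le> real n" using real_arch_simple by blast
  have "1 \<preceq> of_nat m * p" using m pq by (simp add: le_iff_on_subsemiring f_hom)
  from mult_right[OF this, of s] have "s \<preceq> of_nat m * (p * s)" by (simp add: mult_ac)
  also have "\<dots> \<preceq> of_nat m * q" by (rule mult_left[OF pq(4)])
  also have "\<dots> \<preceq> of_nat n" using n pq by (simp add: le_iff_on_subsemiring f_hom)
  finally show ?thesis by blast
qed

lemma nat_lower:
  assumes "s \<noteq> 0"
  shows "\<exists>n::nat. 1 \<preceq> of_nat n * s"
proof -
  obtain p q where pq: "p \<in> A" "q \<in> A" "f p > 0" "p \<preceq> q * s" using lower[OF assms] by blast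
  obtain m where m: "1 \<le> real m * f p"
    using reals_Archimedean3[OF pq(3)] less_imp_le by blast
  obtain n where n: "real m * f q \<le> real n" using real_arch_simple by blast
  have "1 \<preceq> of_nat m * p" using m pq by (simp add: le_iff_on_subsemiring f_hom)
  also have "\<dots> \<preceq> of_nat m * (q * s)" by (rule mult_left[OF pq(4)])
  also have "\<dots> = (of_nat m * q) * s" by (simp add: mult_ac)
  also have "\<dots> \<preceq> of_nat n * s"
    using n pq by (intro mult_right) (simp add: le_iff_on_subsemiring f_hom)
  finally show ?thesis by blast
qed

text \<open>
  The gap between \<open>f q\<close> and \<open>f p\<close> is widened by a factor \<open>m\<close> until an interval \<open>[n, n + 1]\<close> fits
  inside; then \<open>p\<close> and \<open>q\<close> can be replaced by \<open>n + 1\<close> and \<open>n\<close>. Witnesses of this uniform shape for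
  different pairs can be added up.
\<close>

lemma not_le_nat_witness:
  assumes "\<not> a \<preceq> b"
  obtains n :: nat and s where "1 + of_nat n + s * b \<preceq> of_nat n + s * a" "s \<noteq> 0"
proof -
  obtain p q s where pq: "p \<in> A" "q \<in> A" "f q < f p" "p + s * b \<preceq> q + s * a"
    using not_le_witness[OF assms] .
  obtain m where m: "2 \<le> real m * (f p - f q)"
    using reals_Archimedean3[of "f p - f q"] pq(3) less_imp_le by fastforce
  define n where "n = nat \<lceil>real m * f q\<rceil>"
  have "0 \<le> real m * f q" using pq f_nonneg by auto
  then have n: "real m * f q \<le> real n" "real n + 1 \<le> real m * f p"
    using m unfolding n_def by (simp_all add: algebra_simps) linarith+
  have "1 + of_nat n + (of_nat m * s) * b \<preceq> of_nat m * p + (of_nat m * s) * b"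
    using pq n by (intro add_right) (simp add: le_iff_on_subsemiring f_hom)
  also have "\<dots> = of_nat m * (p + s * b)" by (simp add: algebra_simps)
  also have "\<dots> \<preceq> of_nat m * (q + s * a)" by (rule mult_left[OF pq(4)])
  also have "\<dots> = of_nat m * q + (of_nat m * s) * a" by (simp add: algebra_simps)
  also have "\<dots> \<preceq> of_nat n + (of_nat m * s) * a"
    using pq n by (intro add_right) (simp add: le_iff_on_subsemiring f_hom)
  finally have *: "1 + of_nat n + (of_nat m * s) * b \<preceq> of_nat n + (of_nat m * s) * a" .
  moreover have "of_nat m * s \<noteq> 0"
  proof
    assume "of_nat m * s = 0"
    with * have "f (1 + of_nat n) \<le> f (of_nat n)" by (intro f_mono) auto
    then show False by (simp add: f_hom)
  qed
  ultimately show thesis by (rule that)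
qed

text \<open>
  If \<open>a\<close> and \<open>b\<close> were incomparable, there would be witnesses \<open>1 \<le> s * (a - b)\<close> and
  \<open>1 \<le> r * (b - a)\<close>. Multiplying the first by \<open>r\<close>, the second by \<open>s\<close> and adding gives \<open>r + s \<le> 0\<close>,
  with a summand \<open>V\<close> on both sides. This contradicts boundedness: \<open>V\<close> absorbs arbitrarily many
  copies of \<open>r + s\<close>, and so arbitrarily large numbers, because \<open>s\<close> is nonzero.
\<close>

lemma total: "a \<preceq> b \<or> b \<preceq> a"
proof (rule ccontr)
  assume "\<not> ?thesis"
  then have "\<not> a \<preceq> b" "\<not> b \<preceq> a" by auto
  then obtain m n :: nat and r s where
    s: "1 + of_nat m + s * b \<preceq> of_nat m + s * a" "s \<noteq> 0" and
    r: "1 + of_nat n + r * a \<preceq> of_nat n + r * b"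
    using not_le_nat_witness[of a b] not_le_nat_witness[of b a] by metis
  define V where "V = r * of_nat m + s * of_nat n + r * s * (a + b)"
  have "(r + s) + V = r * (1 + of_nat m + s * b) + s * (1 + of_nat n + r * a)"
    by (simp add: V_def algebra_simps)
  also have "\<dots> \<preceq> r * (of_nat m + s * a) + s * (of_nat n + r * b)"
    by (intro add_le_add mult_left s r)
  also have "\<dots> = V" by (simp add: V_def algebra_simps)
  finally have cancel: "(r + s) + V \<preceq> V" .
  obtain v where v: "V \<preceq> of_nat v" using nat_upper by blast
  obtain k where k: "1 \<preceq> of_nat k * s" using nat_lower[OF s(2)] by blast
  have "of_nat (Suc v) \<preceq> of_nat (Suc v) * (of_nat k * s)"
    using mult_left[OF k, of "of_nat (Suc v)"] by (simp only: mult_1_right)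
  also have "\<dots> \<preceq> of_nat (Suc v) * (of_nat k * (r + s))"
    by (intro mult_left le_add2)
  also have "\<dots> = of_nat (Suc v * k) * (r + s)" by (simp only: of_nat_mult mult_ac)
  also have "\<dots> \<preceq> of_nat (Suc v * k) * (r + s) + V" by (rule le_add1)
  also have "\<dots> \<preceq> V" by (rule cancel_iterate[OF cancel])
  also note v
  finally have "f (of_nat (Suc v)) \<le> f (of_nat v)" by (intro f_mono) auto
  then show False by (simp only: f_hom)
qed

lemma of_nat_le_iff: "of_nat p \<preceq> of_nat q \<longleftrightarrow> p \<le> q"
  by (simp add: le_iff_on_subsemiring f_hom)

definition val where
  "val s = Sup {real p / real q | p q. q > 0 \<and> of_nat p \<preceq> of_nat q * s}"

lemma fraction_le:
  assumes "of_nat p \<preceq> of_nat q * s" "of_nat q' * s \<preceq> of_nat p'" "q > 0" "q' > 0"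
  shows "real p / real q \<le> real p' / real q'"
proof -
  have "of_nat (q' * p) \<preceq> of_nat q' * (of_nat q * s)"
    using mult_left[OF assms(1)] by simp
  also have "\<dots> = of_nat q * (of_nat q' * s)" by (simp add: mult_ac)
  also have "\<dots> \<preceq> of_nat (q * p')" using mult_left[OF assms(2)] by simp
  finally have "q' * p \<le> q * p'" by (simp only: of_nat_le_iff)
  then have "real (q' * p) \<le> real (q * p')" by (rule of_nat_mono)
  then show ?thesis using assms(3,4) by (simp add: field_simps)
qed

lemma fractions_nonempty:
  "{real p / real q |p q. 0 < q \<and> of_nat p \<preceq> of_nat q * s} \<noteq> {}"
proof -
  have "real 0 / real 1 \<in> {real p / real q |p q. 0 < q \<and> of_nat p \<preceq> of_nat q * s}"
    by (intro CollectI exI[of _ 0] exI[of _ 1]) simp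
  then show ?thesis by blast
qed

lemma val_upper:
  assumes "of_nat q * s \<preceq> of_nat p" "q > 0"
  shows "val s \<le> real p / real q"
  unfolding val_def
  using fraction_le[OF _ assms(1) _ assms(2)] by (intro cSup_least fractions_nonempty) auto

lemma val_lower:
  assumes "of_nat p \<preceq> of_nat q * s" "q > 0"
  shows "real p / real q \<le> val s"
proof -
  obtain n where "s \<preceq> of_nat n" using nat_upper by blast
  then have "bdd_above {real p / real q |p q. 0 < q \<and> of_nat p \<preceq> of_nat q * s}"
    using fraction_le[of _ _ s 1 n] by (auto simp: bdd_above_def)
  then show ?thesis unfolding val_def using assms by (intro cSup_upper) auto
qed

text \<open>
  Totality turns the cut into an integer part: \<open>q * s\<close> lies between consecutive numbers. That
  \<open>val\<close> extends \<open>f\<close>, is additive and is multiplicative follows by comparing integer parts at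
  denominator \<open>q\<close> and letting \<open>q\<close> grow.
\<close>

lemma val_floor:
  obtains p :: nat where "of_nat p \<preceq> of_nat q * s" "of_nat q * s \<preceq> of_nat (Suc p)"
proof -
  obtain n where n: "of_nat q * s \<preceq> of_nat n" using nat_upper by blast
  define p where "p = (LEAST p. of_nat q * s \<preceq> of_nat (Suc p))"
  have "of_nat q * s \<preceq> of_nat (Suc n)" by (rule le_trans[OF n of_nat_le]) simp
  then have 1: "of_nat q * s \<preceq> of_nat (Suc p)" unfolding p_def by (rule LeastI)
  have 2: "of_nat p \<preceq> of_nat q * s"
  proof (cases p)
    case (Suc p')
    then have "p' < p" by simp
    from not_less_Least[OF this[unfolded p_def]]
    have "\<not> of_nat q * s \<preceq> of_nat (Suc p')" .
    then show ?thesis using total[of "of_nat q * s" "of_nat p"] by (simp only: Suc simp_thms)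
  qed simp
  from 2 1 show thesis by (rule that)
qed

lemma val_bounds:
  assumes "of_nat p \<preceq> of_nat q * s" "of_nat q * s \<preceq> of_nat p'" "q > 0"
  shows "real p \<le> real q * val s" "real q * val s \<le> real p'"
  using val_lower[OF assms(1,3)] val_upper[OF assms(2,3)] assms(3) by (simp_all add: field_simps)

lemma val_nonneg: "0 \<le> val s"
  using val_lower[of 0 1 s] by simp

lemma val_extends:
  assumes "a \<in> A"
  shows "val a = f a"
proof -
  have "real q * \<bar>val a - f a\<bar> \<le> 1" if q: "q > 0" for q
  proof -
    obtain p where p: "of_nat p \<preceq> of_nat q * a" "of_nat q * a \<preceq> of_nat (Suc p)"
      by (rule val_floor)
    have "real p \<le> real q * f a" "real q * f a \<le> real (Suc p)"
      using p assms by (simp_all add: le_iff_on_subsemiring f_hom del: of_nat_Suc)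
    with val_bounds[OF p q] have "\<bar>real q * val a - real q * f a\<bar> \<le> 1" by simp
    then show ?thesis using q by (simp add: abs_mult flip: right_diff_distrib)
  qed
  then show ?thesis using zero_if_multiples_bounded[of "val a - f a" 1] by simp
qed

lemma val_add: "val (a + b) = val a + val b"
proof -
  have "real q * \<bar>val (a + b) - (val a + val b)\<bar> \<le> 2" if q: "q > 0" for q
  proof -
    obtain m where m: "of_nat m \<preceq> of_nat q * a" "of_nat q * a \<preceq> of_nat (Suc m)"
      by (rule val_floor)
    obtain n where n: "of_nat n \<preceq> of_nat q * b" "of_nat q * b \<preceq> of_nat (Suc n)"
      by (rule val_floor)
    have "of_nat (m + n) \<preceq> of_nat q * (a + b)" "of_nat q * (a + b) \<preceq> of_nat (Suc m + Suc n)"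
      using add_le_add[OF m(1) n(1)] add_le_add[OF m(2) n(2)]
      by (simp_all add: algebra_simps)
    from val_bounds[OF this q] val_bounds[OF m q] val_bounds[OF n q]
    have "\<bar>real q * val (a + b) - (real q * val a + real q * val b)\<bar> \<le> 2" by simp
    then show ?thesis using q by (simp add: abs_mult flip: right_diff_distrib distrib_left)
  qed
  then show ?thesis using zero_if_multiples_bounded[of "val (a + b) - (val a + val b)" 2] by simp
qed

lemma val_mult: "val (a * b) = val a * val b"
proof -
  have "real q * \<bar>val (a * b) - val a * val b\<bar> \<le> val a + val b + 1" if q: "q > 0" for q
  proof -
    obtain m where m: "of_nat m \<preceq> of_nat q * a" "of_nat q * a \<preceq> of_nat (Suc m)"
      by (rule val_floor)
    obtain n where n: "of_nat n \<preceq> of_nat q * b" "of_nat q * b \<preceq> of_nat (Suc n)"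
      by (rule val_floor)
    have "of_nat (m * n) \<preceq> of_nat (q * q) * (a * b)"
      "of_nat (q * q) * (a * b) \<preceq> of_nat (Suc m * Suc n)"
      using mult_le_mult[OF m(1) n(1)] mult_le_mult[OF m(2) n(2)]
      by (simp_all only: of_nat_mult mult_ac)
    from val_bounds[OF this] q
    have 1: "real m * real n \<le> real (q * q) * val (a * b)"
      "real (q * q) * val (a * b) \<le> (real m + 1) * (real n + 1)" by (simp_all add: algebra_simps)
    note gm = val_bounds[OF m q] and gn = val_bounds[OF n q]
    have "real m * real n \<le> (real q * val a) * (real q * val b)"
      using gm gn by (intro mult_mono) (auto simp: val_nonneg)
    moreover have "(real q * val a) * (real q * val b) \<le> (real m + 1) * (real n + 1)"
      using gm gn by (intro mult_mono) (auto simp: val_nonneg)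
    ultimately have "\<bar>real (q * q) * val (a * b) - (real q * val a) * (real q * val b)\<bar>
        \<le> real m + real n + 1"
      using 1 by (simp add: algebra_simps abs_le_iff)
    also have "\<dots> \<le> real q * (val a + val b + 1)"
      using gm gn q by (simp add: algebra_simps)
    also have "real (q * q) * val (a * b) - (real q * val a) * (real q * val b)
        = real q * (real q * (val (a * b) - val a * val b))" by (simp add: algebra_simps)
    also have "\<bar>\<dots>\<bar> = real q * (real q * \<bar>val (a * b) - val a * val b\<bar>)" by (simp add: abs_mult)
    finally show ?thesis using q by simp
  qed
  then show ?thesis
    using zero_if_multiples_bounded[of "val (a * b) - val a * val b" "val a + val b + 1"] by simp
qed

lemma val_mono:
  assumes "a \<preceq> b"
  shows "val a \<le> val b"
proof -
  have "real p / real q \<le> val b" if "of_nat p \<preceq> of_nat q * a" "q > 0" for p q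
    using val_lower[OF le_trans[OF that(1) mult_left[OF assms]] that(2)] .
  then show ?thesis
    unfolding val_def[of a] by (intro cSup_least fractions_nonempty) auto
qed

lemma val_spectrum: "val \<in> spectrum UNIV P"
  unfolding spectrum_def
  using val_extends[of 0] val_extends[of 1] f_hom
  by (auto simp: val_nonneg val_add val_mult val_mono)

end

text \<open>
  The homomorphism is constructed for a maximal preorder above \<open>le\<close>; it is then also monotone for \<open>le\<close>.
\<close>

lemma spectrum_extension:
  fixes le :: "'a::comm_semiring_1 \<Rightarrow> 'a \<Rightarrow> bool"
  assumes le: "preordered_semiring le" and "subsemiring A" and f: "f \<in> spectrum A le"
    and "\<And>s. \<exists>p\<in>A. \<exists>q\<in>A. f p > 0 \<and> le (p * s) q"
    and "\<And>s. s \<noteq> 0 \<Longrightarrow> \<exists>p\<in>A. \<exists>q\<in>A. f p > 0 \<and> le p (q * s)"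
  obtains g where "g \<in> spectrum UNIV le" "\<forall>a\<in>A. g a = f a"
proof -
  obtain P where P: "preordered_semiring P" "f \<in> spectrum A P" "le \<le> P"
    "\<forall>Q. preordered_semiring Q \<longrightarrow> f \<in> spectrum A Q \<longrightarrow> P \<le> Q \<longrightarrow> Q \<le> P"
    by (rule maximal_spectrum_preorder[OF le f])
  note leP = predicate2D[OF P(3)]
  interpret maximal_preorder P A f
  proof unfold_locales
    show "\<exists>p\<in>A. \<exists>q\<in>A. 0 < f p \<and> P (p * s) q" for s
      using assms(4)[of s] leP by blast
    show "\<exists>p\<in>A. \<exists>q\<in>A. 0 < f p \<and> P p (q * s)" if "s \<noteq> 0" for s
      using assms(5)[OF that] leP by blast
    show "P a b" if "preordered_semiring Q" "f \<in> spectrum A Q"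
      "\<And>a b. P a b \<Longrightarrow> Q a b" "Q a b" for Q a b
    proof -
      have "Q \<le> P" using P(4) that(1,2) predicate2I[of P Q, OF that(3)] by blast
      then show ?thesis using that(4) by (rule predicate2D)
    qed
  qed (fact P assms)+
  have "val \<in> spectrum UNIV le"
    using val_spectrum leP unfolding spectrum_def by blast
  moreover have "\<forall>a\<in>A. val a = f a" using val_extends by blast
  ultimately show thesis by (rule that)
qed

text \<open>
  The extension result for the image of the natural numbers. The canonical map is injective
  because no \<open>n + 1\<close> is below \<open>n\<close>, so the value \<open>n\<close> at \<open>n\<close> is well defined.
\<close>

lemma bounded_spectrum_nonempty:
  fixes le :: "'a::comm_semiring_1 \<Rightarrow> 'a \<Rightarrow> bool"
  assumes le: "preordered_semiring le"
    and emb: "\<And>n. \<not> le (of_nat (Suc n)) (of_nat n)"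
    and "\<And>s. \<exists>n. le s (of_nat n)"
    and "\<And>s. s \<noteq> 0 \<Longrightarrow> \<exists>n. le 1 (of_nat n * s)"
  shows "spectrum UNIV le \<noteq> {}"
proof -
  interpret preordered le by unfold_locales (rule le)
  define A where "A = range (of_nat :: nat \<Rightarrow> 'a)"
  have mono: "n \<le> m" if "le (of_nat n) (of_nat m)" for n m
  proof (rule ccontr)
    assume "\<not> n \<le> m"
    then have "le (of_nat (Suc m)) (of_nat n)" by (intro of_nat_le) simp
    with that emb show False using le_trans by blast
  qed
  then have inj: "inj (of_nat :: nat \<Rightarrow> 'a)"
    by (intro injI antisym) simp_all
  define f where "f = restrict (\<lambda>a. real (inv of_nat a)) A"
  have f: "f (of_nat n) = real n" for n by (simp add: f_def A_def inv_f_f[OF inj])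
  have A: "subsemiring A"
    unfolding subsemiring_def A_def
    by (auto simp flip: of_nat_add of_nat_mult intro: range_eqI[of _ _ 0] range_eqI[of _ _ 1])
  have "f \<in> spectrum A le"
  proof -
    have "f \<in> A \<rightarrow>\<^sub>E {0..}" by (auto simp: f_def)
    moreover have "f 0 = 0" "f 1 = 1" using f[of 0] f[of 1] by simp_all
    moreover have "f (a + b) = f a + f b \<and> f (a * b) = f a * f b" if "a \<in> A" "b \<in> A" for a b
      using that by (auto simp: A_def f simp flip: of_nat_add of_nat_mult)
    moreover have "f a \<le> f b" if "a \<in> A" "b \<in> A" "le a b" for a b
      using that by (auto simp: A_def f dest: mono)
    ultimately show ?thesis by (simp add: spectrum_def)
  qed
  moreover have mem: "1 \<in> A" "of_nat n \<in> A" for n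
    using A subsemiring_of_nat by (auto simp: subsemiring_def)
  have "\<exists>p\<in>A. \<exists>q\<in>A. 0 < f p \<and> le (p * s) q" for s
  proof -
    from assms(3)[of s] obtain n where "le s (of_nat n)" by blast
    then show ?thesis
      using f[of 1] mem by (intro bexI[of _ 1] bexI[of _ "of_nat n"]) simp_all
  qed
  moreover have "\<exists>p\<in>A. \<exists>q\<in>A. 0 < f p \<and> le p (q * s)" if "s \<noteq> 0" for s
  proof -
    from assms(4)[OF that] obtain n where "le 1 (of_nat n * s)" by blast
    then show ?thesis
      using f[of 1] mem by (intro bexI[of _ 1] bexI[of _ "of_nat n"]) simp_all
  qed
  ultimately obtain g where "g \<in> spectrum UNIV le"
    by (rule spectrum_extension[OF le A])
  then show ?thesis by blast
qed

section \<open>Numerical gaps\<close>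

lemma linear_le_two_power: "\<exists>q. A * q + B \<le> (2::nat) ^ q"
proof -
  define r where "r = 2 * A + B + 1"
  have "A * (2 * r) + B \<le> (2 * A + B) * r" by (simp add: r_def algebra_simps)
  also have "\<dots> \<le> r * r" by (intro mult_right_mono) (simp_all add: r_def)
  also have "\<dots> \<le> 2 ^ r * 2 ^ r" by (intro mult_le_mono less_imp_le less_exp)
  also have "\<dots> = 2 ^ (2 * r)" by (simp add: mult_2 power_add)
  finally show ?thesis by blast
qed

text \<open>
  Bernoulli's inequality for \<open>(1 + 1 / n) ^ (n * B)\<close>. It is this exponential gain that later pays
  for the constants of the crude bound.
\<close>

lemma power_gap: "\<exists>\<kappa>. n ^ \<kappa> * B \<le> (Suc n) ^ \<kappa>"
proof (cases "n = 0")
  case False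
  have "real B \<le> 1 + real (n * B) * (1 / real n)" using False by simp
  also have "\<dots> \<le> (1 + 1 / real n) ^ (n * B)"
    by (rule Bernoulli_inequality) (use False in \<open>auto intro: order_trans[of _ 0]\<close>)
  finally have "real n ^ (n * B) * real B \<le> real n ^ (n * B) * (1 + 1 / real n) ^ (n * B)"
    by (rule mult_left_mono) simp
  also have "\<dots> = real (Suc n) ^ (n * B)"
    using False by (simp add: field_simps flip: power_mult_distrib)
  finally have "real (n ^ (n * B) * B) \<le> real (Suc n ^ (n * B))" by simp
  then show ?thesis by (simp only: of_nat_le_iff) blast
qed (auto intro: exI[of _ 1])

context preordered begin

text \<open>
  From \<open>(b - a) * g \<le> h\<close> one gets \<open>(b ^ j - a ^ j) * g \<le> j * b ^ j * h\<close>. The ratio of the two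
  coefficients of \<open>g\<close> becomes exponentially large in \<open>j\<close>, while the error grows only linearly
  relative to \<open>b ^ j\<close>.
\<close>

lemma iterate_gap:
  assumes "b * g \<preceq> a * g + h" "a \<preceq> b" "1 \<preceq> b"
  shows "b ^ j * g \<preceq> a ^ j * g + of_nat j * b ^ j * h"
proof (induction j)
  case (Suc j)
  have "b ^ Suc j * g = b * (b ^ j * g)" by (simp add: mult_ac)
  also have "\<dots> \<preceq> b * (a ^ j * g + of_nat j * b ^ j * h)" by (rule mult_left[OF Suc.IH])
  also have "\<dots> = a ^ j * (b * g) + of_nat j * b ^ Suc j * h" by (simp add: algebra_simps)
  also have "\<dots> \<preceq> a ^ j * (a * g + h) + of_nat j * b ^ Suc j * h"
    by (rule add_right[OF mult_left[OF assms(1)]])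
  also have "\<dots> = a ^ Suc j * g + (a ^ j * h + of_nat j * b ^ Suc j * h)"
    by (simp add: algebra_simps)
  also have "\<dots> \<preceq> a ^ Suc j * g + (b ^ Suc j * h + of_nat j * b ^ Suc j * h)"
    using le_trans[OF power_le_power[OF assms(2), of j] power_increasing[OF assms(3), of j "Suc j"]]
    by (intro add_left add_right mult_right) simp
  also have "\<dots> = a ^ Suc j * g + of_nat (Suc j) * b ^ Suc j * h" by (simp add: algebra_simps)
  finally show ?case .
qed simp

lemma power_le_geo: "Y ^ k \<preceq> geo X Y (Suc k)"
proof (induction k)
  case (Suc k)
  have "Y ^ Suc k = Y ^ k * Y" by (simp add: mult_ac)
  also have "\<dots> \<preceq> geo X Y (Suc k) * Y" by (rule mult_right[OF Suc.IH])
  also have "\<dots> \<preceq> geo X Y (Suc (Suc k))" unfolding geo.simps(2)[of X Y "Suc k"] by (rule le_add1)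
  finally show ?case .
qed simp

lemma geo_le:
  assumes "c * Y \<preceq> C * X * c" "1 \<preceq> C"
  shows "c * geo X Y (Suc k) \<preceq> of_nat (Suc k) * C ^ k * X ^ k * c"
proof (induction k)
  case (Suc k)
  have "c * geo X Y (Suc (Suc k)) = (c * geo X Y (Suc k)) * Y + 1 * (X ^ Suc k * c)"
    by (simp add: algebra_simps)
  also have "\<dots> \<preceq> (of_nat (Suc k) * C ^ k * X ^ k * c) * Y + C ^ Suc k * (X ^ Suc k * c)"
    using power_increasing[OF assms(2), of 0 "Suc k"]
    by (intro add_le_add mult_right Suc.IH) simp
  also have "\<dots> = of_nat (Suc k) * C ^ k * X ^ k * (c * Y) + C ^ Suc k * (X ^ Suc k * c)"
    by (simp add: algebra_simps)
  also have "\<dots> \<preceq> of_nat (Suc k) * C ^ k * X ^ k * (C * X * c) + C ^ Suc k * (X ^ Suc k * c)"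
    by (rule add_right[OF mult_left[OF assms(1)]])
  also have "\<dots> = of_nat (Suc (Suc k)) * C ^ Suc k * X ^ Suc k * c"
    by (simp add: algebra_simps)
  finally show ?case .
qed simp

end

section \<open>Polynomial growth and the asymptotic preorder\<close>

locale polynomial_growth_semiring = preordered +
  fixes u
  assumes u: "power_universal (\<preceq>) u"
    and embedding: "nat_order_embedding (\<preceq>)"
begin

lemma one_le_u: "1 \<preceq> u"
  using u by (simp add: power_universal_def)

lemma one_le_u_power: "1 \<preceq> u ^ k"
  using power_increasing[OF one_le_u, of 0 k] by simp

lemma of_nat_le_iff: "of_nat n \<preceq> of_nat m \<longleftrightarrow> n \<le> m"
  using embedding by (simp add: nat_order_embedding_def)

lemma not_one_le_zero: "\<not> 1 \<preceq> 0"
  using of_nat_le_iff[of 1 0] by simp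

lemma le_u_power: obtains k where "x \<preceq> u ^ k"
proof (cases "x = 0")
  case True then show ?thesis using that[of 0] by simp
next
  case False then show ?thesis using that u by (auto simp: power_universal_def)
qed

lemma one_le_u_power_mult:
  assumes "x \<noteq> 0"
  obtains k where "1 \<preceq> u ^ k * x"
  using assms u by (auto simp: power_universal_def)

lemma nonzeroI: "1 \<preceq> c * x \<Longrightarrow> x \<noteq> 0"
  using not_one_le_zero by auto

lemma mult_nonzero:
  fixes x y :: 'a
  assumes "x \<noteq> 0" "y \<noteq> 0"
  shows "x * y \<noteq> 0"
proof -
  obtain k where k: "1 \<preceq> u ^ k * x" using one_le_u_power_mult[OF assms(1)] .
  obtain l where l: "1 \<preceq> u ^ l * y" using one_le_u_power_mult[OF assms(2)] .
  show ?thesis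
    using mult_le_mult[OF k l] by (intro nonzeroI[of "u ^ k * u ^ l"]) (simp add: mult_ac)
qed

lemma power_nonzero: "x \<noteq> 0 \<Longrightarrow> x ^ k \<noteq> 0" for x :: 'a
  by (induction k) (simp_all add: mult_nonzero)

lemma of_nat_nonzero: "n > 0 \<Longrightarrow> of_nat n \<noteq> (0::'a)"
  using of_nat_le_iff[of n 0] by (metis le_refl leD of_nat_0)

lemma spectrum_pos:
  assumes "f \<in> spectrum UNIV (\<preceq>)" "x \<noteq> 0"
  shows "f x > 0"
proof -
  obtain k where "1 \<preceq> u ^ k * x" using one_le_u_power_mult[OF assms(2)] .
  then have "f 1 \<le> f (u ^ k * x)" by (intro spectrumD(6)[OF assms(1)]) auto
  then have "1 \<le> f (u ^ k) * f x" using spectrumD[OF assms(1)] by simp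
  then have "f x \<noteq> 0" by auto
  then show ?thesis using spectrumD(3)[OF assms(1), of x] by simp
qed

lemma two_le_u_power: obtains a where "2 \<preceq> u ^ a"
  using le_u_power .

text \<open>
  Every element is below a power of \<open>u\<close>, and a nonzero one is above \<open>1\<close> after multiplication by a
  power of \<open>u\<close>; so a bound on \<open>u\<close> alone bounds everything.
\<close>

lemma spectrum_nonempty_if_bounded:
  assumes Q: "preordered_semiring Q" "\<And>a b. a \<preceq> b \<Longrightarrow> Q a b"
    and "Q u (of_nat C)" and "\<And>n. \<not> Q (of_nat (Suc n)) (of_nat n)"
  shows "spectrum UNIV Q \<noteq> {}"
proof (rule bounded_spectrum_nonempty)
  interpret Q: preordered Q by unfold_locales (rule Q)
  have u: "Q (u ^ k) (of_nat (C ^ k))" for k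
    using Q.power_le_power[OF assms(3)] by simp
  show "\<exists>n. Q s (of_nat n)" for s
    using le_u_power[of s] Q(2) u Q.le_trans by metis
  show "\<exists>n. Q 1 (of_nat n * s)" if "s \<noteq> 0" for s
    using one_le_u_power_mult[OF that] Q(2) Q.mult_right[OF u] Q.le_trans by metis
qed fact+

text \<open>
  It suffices to have, for every \<open>\<epsilon>\<close>, an affine bound of slope \<open>\<epsilon>\<close> on the exponent of \<open>u\<close>. The least
  admissible exponents satisfy all these bounds at once.
\<close>

lemma asymptotically_geI:
  assumes "\<And>\<epsilon>::real. \<epsilon> > 0 \<Longrightarrow> \<exists>D. \<forall>n. \<exists>k. real k \<le> \<epsilon> * real n + D \<and> y ^ n \<preceq> u ^ k * x ^ n"
  shows "asymptotically_ge (\<preceq>) u x y"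
proof -
  define k where "k n = (LEAST k. y ^ n \<preceq> u ^ k * x ^ n)" for n
  have k: "y ^ n \<preceq> u ^ k n * x ^ n" for n
    unfolding k_def by (rule LeastI_ex) (use assms[of 1] in auto)
  have "(\<lambda>n. real (k n) / real n) \<longlonglongrightarrow> 0"
  proof (rule LIMSEQ_I)
    fix \<epsilon> :: real assume \<epsilon>: "\<epsilon> > 0"
    then obtain D where D: "\<And>n. \<exists>k. real k \<le> \<epsilon> / 2 * real n + D \<and> y ^ n \<preceq> u ^ k * x ^ n"
      using assms[of "\<epsilon> / 2"] by auto
    have le: "real (k n) \<le> \<epsilon> / 2 * real n + D" for n
    proof -
      obtain l where "real l \<le> \<epsilon> / 2 * real n + D" "y ^ n \<preceq> u ^ l * x ^ n" using D by blast
      moreover from this have "k n \<le> l" unfolding k_def by (intro Least_le)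
      ultimately show ?thesis by simp
    qed
    obtain n0 :: nat where n0: "2 * D < real n0 * \<epsilon>"
      using reals_Archimedean3[OF \<epsilon>] by blast
    have "norm (real (k n) / real n - 0) < \<epsilon>" if "n \<ge> Suc n0" for n
    proof -
      have "real n0 * \<epsilon> \<le> real n * \<epsilon>" using that \<epsilon> by (intro mult_right_mono) auto
      with n0 le[of n] have "real (k n) < \<epsilon> * real n" by (simp add: algebra_simps)
      with that show ?thesis by (simp add: field_simps)
    qed
    then show "\<exists>n0. \<forall>n\<ge>n0. norm (real (k n) / real n - 0) < \<epsilon>" by blast
  qed
  with k show ?thesis unfolding asymptotically_ge_def by blast
qed

text \<open>
  One inequality between \<open>P\<close>-th powers, even multiplied by a nonzero \<open>w\<close>, controls all powers. It
  can be iterated with the same \<open>w\<close>, so that \<open>w\<close> costs only a constant power of \<open>u\<close>; the remainder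
  \<open>n mod P\<close> costs another constant.
\<close>

lemma power_bound_from_single:
  assumes "w \<noteq> 0" "x \<noteq> 0" and step: "w * y ^ P \<preceq> u ^ e * x ^ P * w" and "P > 0"
  obtains D where "\<And>n. y ^ n \<preceq> u ^ (e * (n div P) + D) * x ^ n"
proof -
  obtain a where a: "y \<preceq> u ^ a" using le_u_power .
  obtain b where b: "1 \<preceq> u ^ b * x" using one_le_u_power_mult[OF assms(2)] .
  obtain c where c: "w \<preceq> u ^ c" using le_u_power .
  obtain d where d: "1 \<preceq> u ^ d * w" using one_le_u_power_mult[OF assms(1)] .
  have yx: "y \<preceq> u ^ (a + b) * x"
    using mult_le_mult[OF a b] by (simp add: power_add mult_ac)
  have "y ^ n \<preceq> u ^ (e * (n div P) + (c + d + (a + b) * P)) * x ^ n" for n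
  proof -
    let ?j = "n div P" and ?r = "n mod P"
    have "y ^ (P * ?j) \<preceq> u ^ d * w * (y ^ P) ^ ?j"
      using mult_right[OF d, of "(y ^ P) ^ ?j"] by (simp add: power_mult)
    also have "\<dots> = u ^ d * (w * (y ^ P) ^ ?j)" by (simp add: mult_ac)
    also have "\<dots> \<preceq> u ^ d * ((u ^ e * x ^ P) ^ ?j * w)"
      by (rule mult_left[OF mult_power_le[OF step]])
    also have "\<dots> \<preceq> u ^ d * ((u ^ e * x ^ P) ^ ?j * u ^ c)"
      by (intro mult_left c)
    also have "\<dots> = u ^ (e * ?j + (c + d)) * x ^ (P * ?j)"
      by (simp add: power_add power_mult power_mult_distrib mult_ac)
    finally have 1: "y ^ (P * ?j) \<preceq> u ^ (e * ?j + (c + d)) * x ^ (P * ?j)" .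
    have "y ^ ?r \<preceq> (u ^ (a + b) * x) ^ ?r" by (rule power_le_power[OF yx])
    also have "\<dots> = u ^ ((a + b) * ?r) * x ^ ?r" by (simp add: power_mult power_mult_distrib)
    also have "\<dots> \<preceq> u ^ ((a + b) * P) * x ^ ?r"
      using assms(4) by (intro mult_right power_increasing one_le_u mult_left_mono) (auto simp: less_imp_le)
    finally have 2: "y ^ ?r \<preceq> u ^ ((a + b) * P) * x ^ ?r" .
    have "y ^ n = y ^ (P * ?j) * y ^ ?r" by (simp flip: power_add)
    also have "\<dots> \<preceq> (u ^ (e * ?j + (c + d)) * x ^ (P * ?j)) * (u ^ ((a + b) * P) * x ^ ?r)"
      by (rule mult_le_mult[OF 1 2])
    also have "\<dots> = u ^ (e * ?j + (c + d + (a + b) * P)) * x ^ (P * ?j + ?r)"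
      by (simp only: power_add mult_ac)
    finally show ?thesis by simp
  qed
  then show thesis by (rule that)
qed

section \<open>From pointwise inequalities to the asymptotic preorder\<close>

text \<open>
  The Positivstellensatz step. The spectrum of the preorder with \<open>u * x ^ N \<preceq> y ^ N\<close> adjoined
  is empty, so that preorder is degenerate; the degeneracy is an inequality
  \<open>d * (n + 1) + s * Y \<preceq> d * n + s * X\<close>. With \<open>G = geo X Y (k + 1)\<close> it becomes
  \<open>(n + 1) * (d * G) \<preceq> n * (d * G) + s * X ^ (k + 1)\<close>, and iterating it \<open>j\<close> times
  \<open>(n + 1) ^ j * (d * G) \<preceq> n ^ j * (d * G) + j * (n + 1) ^ j * s * X ^ (k + 1)\<close>.
  On the right the crude bound \<open>c * Y \<preceq> C * X * c\<close> gives
  \<open>c * G \<preceq> (k + 1) * C ^ k * X ^ k * c\<close>, and the exponential factor \<open>(k + 1) * C ^ k\<close> is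
  absorbed by the ratio of \<open>(n + 1) ^ j\<close> to \<open>n ^ j\<close> when \<open>j\<close> is a large multiple of \<open>k\<close>. What remains is
  \<open>Y ^ k \<preceq> X ^ k\<close> up to a factor \<open>(j + 1) * u ^ L\<close> that is linear in \<open>k\<close>, hence below \<open>u ^ k\<close>
  for suitable \<open>k\<close>; and \<open>X ^ k\<close> contributes another \<open>u ^ k\<close>.
\<close>

lemma single_power_bound:
  assumes xyc: "x \<noteq> 0" "c \<noteq> 0" and c: "c * y \<preceq> of_nat n\<^sub>0 * x * c"
    and f: "\<And>f. f \<in> spectrum UNIV (\<preceq>) \<Longrightarrow> f y \<le> f x"
  obtains w K where "w \<noteq> 0" "K > 0" "w * y ^ (N * K) \<preceq> u ^ (2 * K) * x ^ (N * K) * w"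
proof -
  define X Y where "X = u * x ^ N" and "Y = y ^ N"
  define C where "C = Suc (n\<^sub>0 ^ N)"
  have "c * Y \<preceq> (of_nat n\<^sub>0 * x) ^ N * c"
    unfolding Y_def by (rule mult_power_le[OF c])
  also have "\<dots> = of_nat (n\<^sub>0 ^ N) * (x ^ N * c)" by (simp add: power_mult_distrib mult_ac)
  also have "\<dots> \<preceq> of_nat C * (x ^ N * c)" by (intro mult_right of_nat_le) (simp add: C_def)
  finally have cY: "c * Y \<preceq> of_nat C * (x ^ N * c)" .
  let ?Q = "adjoin {d. d \<noteq> 0} (\<preceq>) X Y"
  have Q: "preordered_semiring ?Q" by (intro adjoin_preordered) (simp_all add: mult_nonzero)
  \<comment> \<open>Otherwise a point of the spectrum of the enlarged preorder would have \<open>f u \<le> 1\<close>.\<close>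
  have "\<exists>n. ?Q (of_nat (Suc n)) (of_nat n)"
  proof (rule ccontr)
    assume no: "\<not> ?thesis"
    \<comment> \<open>The crude bound, read in the enlarged preorder: \<open>u * x ^ N \<preceq> y ^ N \<preceq> C * x ^ N\<close>, and
      \<open>c * x ^ N\<close> cancels.\<close>
    have "(c * x ^ N) * u + c * Y \<preceq> (c * x ^ N) * u + of_nat C * (x ^ N * c)"
      by (rule add_left[OF cY])
    also have "\<dots> = (c * x ^ N) * of_nat C + c * X" by (simp add: X_def algebra_simps)
    finally have "?Q u (of_nat C)"
      unfolding adjoin_def using mult_nonzero[OF xyc(2) power_nonzero[OF xyc(1), of N]] by blast
    then have "spectrum UNIV ?Q \<noteq> {}"
      using no by (intro spectrum_nonempty_if_bounded[OF Q adjoin_base]) auto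
    then obtain f where fQ: "f \<in> spectrum UNIV ?Q" by blast
    then have fS: "f \<in> spectrum UNIV (\<preceq>)"
      using adjoin_base[of "{d. d \<noteq> 0}" _ _ X Y] by (auto simp: spectrum_def)
    have sub: "subsemiring (UNIV :: 'a set)" by (simp add: subsemiring_def)
    note fs = spectrumD[OF fS] spectrum_power[OF sub fS UNIV_I] spectrum_of_nat[OF sub fS]
    have "f X \<le> f Y" using adjoin_new[of "{d. d \<noteq> 0}" X Y] by (intro spectrumD(6)[OF fQ]) auto
    then have "f u * f x ^ N \<le> f y ^ N" by (simp add: X_def Y_def fs)
    also have "\<dots> \<le> f x ^ N" using f[OF fS] fs by (intro power_mono) auto
    finally have "f u \<le> 1" using spectrum_pos[OF fS xyc(1)] by simp
    obtain a where "2 \<preceq> u ^ a" by (rule two_le_u_power)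
    then have "f (of_nat 2) \<le> f (u ^ a)" by (intro fs(6)) auto
    then have "2 \<le> f u ^ a" by (simp only: fs)
    also have "\<dots> \<le> 1" using \<open>f u \<le> 1\<close> fs by (intro power_le_one) auto
    finally show False by simp
  qed
  then obtain n s d where d: "d \<noteq> 0" and
    gap: "d * of_nat (Suc n) + s * Y \<preceq> d * of_nat n + s * X"
    unfolding adjoin_def by blast
  obtain \<kappa> where \<kappa>: "n ^ \<kappa> * (2 * C) \<le> Suc n ^ \<kappa>" using power_gap by blast
  obtain l1 where l1: "d \<preceq> u ^ l1" using le_u_power .
  obtain l2 where l2: "s * X \<preceq> u ^ l2" using le_u_power .
  obtain l3 where l3: "1 \<preceq> u ^ l3 * d" using one_le_u_power_mult[OF d] .
  obtain a where a: "2 \<preceq> u ^ a" by (rule two_le_u_power)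
  define L where "L = l1 + l2 + l3"
  \<comment> \<open>The exponent \<open>L\<close> does not depend on \<open>k\<close>.\<close>
  have key: "\<exists>w. w \<noteq> 0 \<and> w * Y ^ k \<preceq> of_nat (Suc (\<kappa> * k)) * u ^ L * X ^ k * w" for k
  proof -
    define j where "j = \<kappa> * k"
    define b :: 'a where "b = of_nat (Suc n)"
    let ?G = "geo X Y (Suc k)"
    have b: "1 \<preceq> b" using of_nat_le[of 1 "Suc n"] by (simp add: b_def)
    have nb: "of_nat n \<preceq> b" unfolding b_def by (rule of_nat_le) simp
    have b0: "b ^ j * c \<noteq> 0"
      unfolding b_def using xyc(2) of_nat_nonzero[of "Suc n"] by (intro mult_nonzero power_nonzero) auto
    have "b * (d * ?G) \<preceq> (d * of_nat (Suc n)) * ?G + s * Y ^ Suc k"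
      using le_add1[of "b * (d * ?G)" "s * Y ^ Suc k"] by (simp add: b_def mult_ac)
    also have "\<dots> \<preceq> (d * of_nat n) * ?G + s * X ^ Suc k" by (rule geo_telescope[OF gap])
    finally have "b * (d * ?G) \<preceq> of_nat n * (d * ?G) + s * X ^ Suc k" by (simp add: mult_ac)
    then have it: "b ^ j * (d * ?G) \<preceq> of_nat n ^ j * (d * ?G) + of_nat j * b ^ j * (s * X ^ Suc k)"
      by (rule iterate_gap[OF _ nb b])
    have nums: "n ^ j * (Suc k * C ^ k) \<le> Suc n ^ j"
    proof -
      have "n ^ j * (Suc k * C ^ k) \<le> n ^ j * (2 ^ k * C ^ k)"
        by (intro mult_left_mono mult_right_mono) (auto simp: Suc_le_eq)
      also have "\<dots> = (n ^ \<kappa> * (2 * C)) ^ k"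
        by (simp add: j_def power_mult power_mult_distrib)
      also have "\<dots> \<le> (Suc n ^ \<kappa>) ^ k" using \<kappa> by (rule power_mono) simp
      finally show ?thesis by (simp add: j_def power_mult)
    qed
    have cYX: "c * Y \<preceq> of_nat C * X * c"
    proof -
      have "x ^ N * c \<preceq> u * (x ^ N * c)" using mult_right[OF one_le_u, of "x ^ N * c"] by simp
      from le_trans[OF cY mult_left[OF this]] show ?thesis by (simp add: X_def mult_ac)
    qed
    have "1 \<preceq> of_nat C" using of_nat_le[of 1 C] by (simp add: C_def)
    note cG = geo_le[OF cYX this, of k]
    have "of_nat n ^ j * (d * ?G) * c = of_nat n ^ j * d * (c * ?G)" by (simp add: mult_ac)
    also have "\<dots> \<preceq> of_nat n ^ j * d * (of_nat (Suc k) * of_nat C ^ k * X ^ k * c)"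
      by (rule mult_left[OF cG])
    also have "\<dots> = of_nat (n ^ j * (Suc k * C ^ k)) * (d * X ^ k * c)"
      by (simp only: of_nat_mult of_nat_power mult_ac)
    also have "\<dots> \<preceq> of_nat (Suc n ^ j) * (d * X ^ k * c)"
      by (intro mult_right of_nat_le nums)
    also have "\<dots> = b ^ j * c * X ^ k * d" by (simp add: b_def mult_ac)
    finally have nG: "of_nat n ^ j * (d * ?G) * c \<preceq> b ^ j * c * X ^ k * d" .
    have lL: "u ^ l1 \<preceq> u ^ (l1 + l2)" "u ^ l2 \<preceq> u ^ (l1 + l2)"
      by (intro power_increasing one_le_u; simp)+
    have "(b ^ j * c * d) * Y ^ k \<preceq> (b ^ j * c * d) * ?G" by (intro mult_left power_le_geo)
    also have "\<dots> = b ^ j * (d * ?G) * c" by (simp only: mult_ac)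
    also have "\<dots> \<preceq> (of_nat n ^ j * (d * ?G) + of_nat j * b ^ j * (s * X ^ Suc k)) * c"
      by (rule mult_right[OF it])
    also have "\<dots> = of_nat n ^ j * (d * ?G) * c + b ^ j * c * X ^ k * (of_nat j * (s * X))"
      by (simp only: distrib_right distrib_left power_Suc mult_ac)
    also have "\<dots> \<preceq> b ^ j * c * X ^ k * d + b ^ j * c * X ^ k * (of_nat j * (s * X))"
      by (rule add_right[OF nG])
    also have "\<dots> = b ^ j * c * X ^ k * (d + of_nat j * (s * X))"
      by (simp only: distrib_left)
    also have "\<dots> \<preceq> b ^ j * c * X ^ k * (u ^ (l1 + l2) + of_nat j * u ^ (l1 + l2))"
      by (intro mult_left add_le_add le_trans[OF l1 lL(1)] le_trans[OF l2 lL(2)])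
    also have "\<dots> = of_nat (Suc j) * u ^ (l1 + l2) * X ^ k * (1 * (b ^ j * c))"
      by (simp add: algebra_simps)
    also have "\<dots> \<preceq> of_nat (Suc j) * u ^ (l1 + l2) * X ^ k * ((u ^ l3 * d) * (b ^ j * c))"
      by (intro mult_left mult_right l3)
    also have "\<dots> = of_nat (Suc j) * u ^ L * X ^ k * (b ^ j * c * d)"
      by (simp only: L_def power_add mult_ac)
    finally show ?thesis using mult_nonzero[OF b0 d] unfolding j_def by blast
  qed
  \<comment> \<open>\<open>K\<close> must satisfy \<open>\<kappa> * K + 1 \<le> 2 ^ q\<close> and \<open>a * q + L \<le> K\<close>: the number is then below \<open>u ^ (a * q)\<close>.\<close>
  obtain q where q: "(\<kappa> * a) * q + (\<kappa> * Suc L + 1) \<le> 2 ^ q" using linear_le_two_power by blast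
  define K where "K = a * q + Suc L"
  from q have qK: "Suc (\<kappa> * K) \<le> 2 ^ q" by (simp add: K_def algebra_simps)
  obtain w where w: "w \<noteq> 0" "w * Y ^ K \<preceq> of_nat (Suc (\<kappa> * K)) * u ^ L * X ^ K * w"
    using key by blast
  have "of_nat (Suc (\<kappa> * K)) \<preceq> (of_nat (2 ^ q) :: 'a)" by (rule of_nat_le[OF qK])
  also have "\<dots> = 2 ^ q" by simp
  also have "\<dots> \<preceq> (u ^ a) ^ q" by (rule power_le_power[OF a])
  finally have "of_nat (Suc (\<kappa> * K)) * u ^ L \<preceq> u ^ (a * q) * u ^ L"
    by (intro mult_right) (simp add: power_mult)
  also have "\<dots> = u ^ (a * q + L)" by (simp add: power_add)
  also have "\<dots> \<preceq> u ^ K" by (intro power_increasing one_le_u) (simp add: K_def)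
  finally have num: "of_nat (Suc (\<kappa> * K)) * u ^ L \<preceq> u ^ K" .
  note w(2)
  also have "of_nat (Suc (\<kappa> * K)) * u ^ L * X ^ K * w \<preceq> u ^ K * X ^ K * w"
    by (intro mult_right num)
  also have "\<dots> = u ^ (2 * K) * x ^ (N * K) * w"
    by (simp only: X_def power_mult_distrib power_mult[symmetric] power_add mult_2 mult_2_right mult_ac)
  finally have "w * y ^ (N * K) \<preceq> u ^ (2 * K) * x ^ (N * K) * w"
    by (simp add: Y_def power_mult)
  with w(1) show thesis by (intro that[of w K]) (simp_all add: K_def)
qed

text \<open>
  For given \<open>\<epsilon>\<close> the previous bound is used with \<open>2 / N < \<epsilon>\<close>.
\<close>

lemma asymptotically_ge_if_spectrum:
  assumes "x \<noteq> 0" "c \<noteq> 0" "c * y \<preceq> of_nat n\<^sub>0 * x * c"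
    and "\<And>f. f \<in> spectrum UNIV (\<preceq>) \<Longrightarrow> f y \<le> f x"
  shows "asymptotically_ge (\<preceq>) u x y"
proof (rule asymptotically_geI)
  fix \<epsilon> :: real assume "\<epsilon> > 0"
  then obtain N where N: "2 < real N * \<epsilon>" using reals_Archimedean3 by blast
  then have "N > 0" by (cases N) auto
  obtain w K where wK: "w \<noteq> 0" "K > 0" "w * y ^ (N * K) \<preceq> u ^ (2 * K) * x ^ (N * K) * w"
    using single_power_bound[OF assms] by blast
  then obtain D where D: "\<And>n. y ^ n \<preceq> u ^ (2 * K * (n div (N * K)) + D) * x ^ n"
    using power_bound_from_single[OF wK(1) assms(1) wK(3)] \<open>N > 0\<close> by auto
  have "real (2 * K * (n div (N * K)) + D) \<le> \<epsilon> * real n + real D" for n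
  proof -
    have "2 * (real K * real (n div (N * K))) \<le> (real N * \<epsilon>) * (real K * real (n div (N * K)))"
      using N by (intro mult_right_mono) auto
    also have "\<dots> = \<epsilon> * real (N * K * (n div (N * K)))" by simp
    also have "\<dots> \<le> \<epsilon> * real n" using \<open>\<epsilon> > 0\<close> by (intro mult_left_mono of_nat_mono) auto
    finally show ?thesis by simp
  qed
  with D show "\<exists>D. \<forall>n. \<exists>k. real k \<le> \<epsilon> * real n + D \<and> y ^ n \<preceq> u ^ k * x ^ n" by blast
qed

lemma spectrum_le_if_asymptotically_ge:
  assumes "asymptotically_ge (\<preceq>) u x y" and f: "f \<in> spectrum UNIV (\<preceq>)"
  shows "f y \<le> f x"
proof -
  obtain k where k: "(\<lambda>n. real (k n) / real n) \<longlonglongrightarrow> 0" "\<And>n. y ^ n \<preceq> u ^ k n * x ^ n"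
    using assms(1) unfolding asymptotically_ge_def by blast
  have sub: "subsemiring (UNIV :: 'a set)" by (simp add: subsemiring_def)
  note fs = spectrumD[OF f] spectrum_power[OF sub f]
  have fu: "1 \<le> f u" using fs(6)[OF _ _ one_le_u] fs(2) by simp
  have bound: "f y \<le> f u powr (real (k n) / real n) * f x" if n: "n > 0" for n
  proof -
    have "f y ^ n \<le> f u ^ k n * f x ^ n"
      using fs(6)[OF _ _ k(2)[of n]] by (simp add: fs)
    also have "f u ^ k n = (f u powr (real (k n) / real n)) ^ n"
      using n fu by (simp add: powr_realpow[symmetric] powr_powr)
    finally have "f y ^ n \<le> (f u powr (real (k n) / real n) * f x) ^ n"
      by (simp add: power_mult_distrib)
    then show ?thesis using n fs(3) by (rule_tac power_le_imp_le_base[of _ "n - 1"]) simp_all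
  qed
  have "(\<lambda>n. f u powr (real (k n) / real n) * f x) \<longlonglongrightarrow> f u powr 0 * f x"
    using fu by (intro tendsto_intros k(1)) auto
  moreover have "\<forall>\<^sub>F n in sequentially. f y \<le> f u powr (real (k n) / real n) * f x"
    using eventually_gt_at_top[of 0] by eventually_elim (rule bound)
  ultimately have "f y \<le> f u powr 0 * f x"
    by (intro tendsto_lowerbound) auto
  then show ?thesis using fu by simp
qed

end

section \<open>Semirings controlled by generators\<close>

text \<open>
  The hypotheses of the theorem: nonzero elements are invertible up to constants by fractions
  \<open>m * t1 / t2\<close>, and such a fraction is bounded in the preorder if it is bounded on the spectrum of \<open>S\<^sub>0\<close>.
\<close>

locale commensurable_generators = polynomial_growth_semiring le u
  for le :: "'a::comm_semiring_1 \<Rightarrow> 'a \<Rightarrow> bool" (infix "\<preceq>" 50) and u +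
  fixes M T S\<^sub>0 :: "'a set"
  assumes T: "multiplicative_set T" "1 \<in> T"
    and S\<^sub>0: "S\<^sub>0 = generated_subsemiring (M \<union> T)"
    and inverse_up_to_constants: "\<And>s. s \<noteq> 0 \<Longrightarrow> \<exists>m\<in>M. \<exists>t1\<in>T. \<exists>t2\<in>T. \<exists>n::nat.
                t2 \<preceq> of_nat n * m * t1 * s \<and> m * t1 * s \<preceq> of_nat n * t2"
    and bounded_ratio: "\<And>m t1 t2. m \<in> M \<Longrightarrow> t1 \<in> T \<Longrightarrow> t2 \<in> T \<Longrightarrow>
                bounded (ev_ratio m t1 t2 ` spectrum S\<^sub>0 (\<preceq>)) \<Longrightarrow>
                \<exists>n::nat. m * t1 \<preceq> of_nat n * t2"
begin

lemma T_nonzero: "t \<in> T \<Longrightarrow> t \<noteq> 0"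
  and T_mult: "t1 \<in> T \<Longrightarrow> t2 \<in> T \<Longrightarrow> t1 * t2 \<in> T"
  using T by (auto simp: multiplicative_set_def)

lemma subsemiring_S\<^sub>0: "subsemiring S\<^sub>0"
  and M_subset: "M \<subseteq> S\<^sub>0" and T_subset: "T \<subseteq> S\<^sub>0"
proof -
  have "subsemiring (subsemiring hull (M \<union> T))"
    by (rule hull_in) (auto simp: subsemiring_def)
  then show "subsemiring S\<^sub>0" by (simp add: S\<^sub>0 generated_subsemiring_def)
  show "M \<subseteq> S\<^sub>0" "T \<subseteq> S\<^sub>0"
    using hull_subset[of "M \<union> T" subsemiring] by (auto simp: S\<^sub>0 generated_subsemiring_def)
qed

lemma obtain_inverse:
  assumes "s \<noteq> 0"
  obtains m t1 t2 n where "m \<in> M" "m \<noteq> 0" "t1 \<in> T" "t2 \<in> T"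
    "t2 \<preceq> of_nat n * (m * t1 * s)" "m * t1 * s \<preceq> of_nat n * t2"
proof -
  obtain m t1 t2 n where m: "m \<in> M" "t1 \<in> T" "t2 \<in> T"
    "t2 \<preceq> of_nat n * (m * t1 * s)" "m * t1 * s \<preceq> of_nat n * t2"
    using inverse_up_to_constants[OF assms] by (auto simp: mult.assoc)
  have "m \<noteq> 0"
  proof
    assume "m = 0"
    with m have "t2 \<preceq> 0" by simp
    moreover obtain k where "1 \<preceq> u ^ k * t2"
      using one_le_u_power_mult[OF T_nonzero[OF m(3)]] .
    ultimately have "1 \<preceq> 0" using le_trans mult_left[of t2 0 "u ^ k"] by simp
    with not_one_le_zero show False by simp
  qed
  with m that show thesis by blast
qed

text \<open>
  The inverse of the inverse. If \<open>m * t1 / t2\<close> is inverse to \<open>s\<close>, then an inverse of \<open>m\<close>, multiplied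
  by \<open>t2 / t1\<close>, is commensurable to \<open>s\<close>.
\<close>

lemma obtain_commensurable:
  assumes "s \<noteq> 0"
  obtains m t1 t2 n where "m \<in> M" "m \<noteq> 0" "t1 \<in> T" "t2 \<in> T"
    "t2 * s \<preceq> of_nat n * (m * t1)" "m * t1 \<preceq> of_nat n * (t2 * s)"
proof -
  obtain m t1 t2 n where m: "m \<in> M" "m \<noteq> 0" "t1 \<in> T" "t2 \<in> T"
    "t2 \<preceq> of_nat n * (m * t1 * s)" "m * t1 * s \<preceq> of_nat n * t2"
    using obtain_inverse[OF assms] .
  obtain m' t1' t2' n' where m': "m' \<in> M" "m' \<noteq> 0" "t1' \<in> T" "t2' \<in> T"
    "t2' \<preceq> of_nat n' * (m' * t1' * m)" "m' * t1' * m \<preceq> of_nat n' * t2'"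
    using obtain_inverse[OF m(2)] .
  have "(t2' * t1) * s \<preceq> (of_nat n' * (m' * t1' * m)) * (t1 * s)"
    using mult_right[OF m'(5), of "t1 * s"] by (simp add: mult_ac)
  also have "\<dots> = of_nat n' * (m' * t1') * (m * t1 * s)" by (simp add: mult_ac)
  also have "\<dots> \<preceq> of_nat n' * (m' * t1') * (of_nat n * t2)" by (rule mult_left[OF m(6)])
  also have "\<dots> = of_nat (n * n') * (m' * (t1' * t2))" by (simp add: mult_ac)
  finally have 1: "(t2' * t1) * s \<preceq> of_nat (n * n') * (m' * (t1' * t2))" .
  have "m' * (t1' * t2) \<preceq> m' * t1' * (of_nat n * (m * t1 * s))"
    using mult_left[OF m(5), of "m' * t1'"] by (simp add: mult_ac)
  also have "\<dots> = of_nat n * (t1 * s) * (m' * t1' * m)" by (simp add: mult_ac)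
  also have "\<dots> \<preceq> of_nat n * (t1 * s) * (of_nat n' * t2')" by (rule mult_left[OF m'(6)])
  also have "\<dots> = of_nat (n * n') * ((t2' * t1) * s)" by (simp add: mult_ac)
  finally show thesis
    using that[OF m'(1,2) T_mult[OF m'(3) m(4)] T_mult[OF m'(4) m(3)] 1] by simp
qed

text \<open>
  Apply the previous lemma to \<open>y * m * t1\<close>, where \<open>m * t1 / t2\<close> is an inverse of \<open>x\<close>.
\<close>

lemma obtain_commensurable_ratio:
  assumes "x \<noteq> 0" "y \<noteq> 0"
  obtains m t1 t2 n where "m \<in> M" "t1 \<in> T" "t2 \<in> T"
    "t2 * y \<preceq> of_nat n * (m * t1 * x)" "m * t1 * x \<preceq> of_nat n * (t2 * y)"
proof -
  obtain m t1 t2 n where m: "m \<in> M" "m \<noteq> 0" "t1 \<in> T" "t2 \<in> T"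
    "t2 \<preceq> of_nat n * (m * t1 * x)" "m * t1 * x \<preceq> of_nat n * t2"
    using obtain_inverse[OF assms(1)] .
  have "y * m * t1 \<noteq> 0" using assms(2) m T_nonzero by (intro mult_nonzero) auto
  then obtain m' t1' t2' n' where m': "m' \<in> M" "m' \<noteq> 0" "t1' \<in> T" "t2' \<in> T"
    "t2' * (y * m * t1) \<preceq> of_nat n' * (m' * t1')" "m' * t1' \<preceq> of_nat n' * (t2' * (y * m * t1))"
    by (rule obtain_commensurable)
  have "(t2' * t2) * y \<preceq> t2' * y * (of_nat n * (m * t1 * x))"
    using mult_left[OF m(5), of "t2' * y"] by (simp add: mult_ac)
  also have "\<dots> = of_nat n * x * (t2' * (y * m * t1))" by (simp add: mult_ac)
  also have "\<dots> \<preceq> of_nat n * x * (of_nat n' * (m' * t1'))" by (rule mult_left[OF m'(5)])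
  also have "\<dots> = of_nat (n * n') * (m' * t1' * x)" by (simp add: mult_ac)
  finally have 1: "(t2' * t2) * y \<preceq> of_nat (n * n') * (m' * t1' * x)" .
  have "m' * t1' * x \<preceq> of_nat n' * (t2' * (y * m * t1)) * x" by (rule mult_right[OF m'(6)])
  also have "\<dots> = of_nat n' * t2' * y * (m * t1 * x)" by (simp add: mult_ac)
  also have "\<dots> \<preceq> of_nat n' * t2' * y * (of_nat n * t2)" by (rule mult_left[OF m(6)])
  also have "\<dots> = of_nat (n * n') * ((t2' * t2) * y)" by (simp add: mult_ac)
  finally show thesis using that[OF m'(1,3) T_mult[OF m'(4) m(4)] 1] by simp
qed

text \<open>
  Homomorphisms on \<open>S\<^sub>0\<close> may vanish at nonzero elements, since \<open>u\<close> need not belong to \<open>S\<^sub>0\<close>, and those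
  that do cannot be extended. This can be tested at a single element \<open>t\<^sub>0\<close> of \<open>T\<close>, the denominator
  of a fraction commensurable to \<open>u\<close>: \<open>t\<^sub>0 * u\<close> is below an element of \<open>S\<^sub>0\<close>, so for every nonzero
  \<open>s\<close> in \<open>S\<^sub>0\<close> the inequality \<open>1 \<preceq> u ^ k * s\<close> multiplied by \<open>t\<^sub>0 ^ k\<close> can be evaluated in \<open>S\<^sub>0\<close>,
  and \<open>f t\<^sub>0 > 0\<close> forces \<open>f s > 0\<close>.
\<close>

lemma obtain_extension_test:
  obtains t\<^sub>0 where "t\<^sub>0 \<in> T"
    "\<forall>f\<in>spectrum S\<^sub>0 (\<preceq>). f t\<^sub>0 \<noteq> 0 \<longrightarrow>
       (\<exists>g\<in>spectrum UNIV (\<preceq>). \<forall>a\<in>S\<^sub>0. g a = f a)"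
proof -
  have "u \<noteq> 0" using one_le_u not_one_le_zero by auto
  then obtain m t1 t\<^sub>0 n where m: "m \<in> M" "m \<noteq> 0" "t1 \<in> T" "t\<^sub>0 \<in> T"
    "t\<^sub>0 * u \<preceq> of_nat n * (m * t1)" "m * t1 \<preceq> of_nat n * (t\<^sub>0 * u)"
    by (rule obtain_commensurable)
  have "\<exists>g\<in>spectrum UNIV (\<preceq>). \<forall>a\<in>S\<^sub>0. g a = f a" if f: "f \<in> spectrum S\<^sub>0 (\<preceq>)" "f t\<^sub>0 \<noteq> 0" for f
  proof -
    note A = subsemiring_S\<^sub>0
    note fs = spectrumD(1,2,4,5)[OF f(1)] spectrum_power[OF A f(1)] spectrum_of_nat[OF A f(1)]
    have cl: "\<And>a b. a \<in> S\<^sub>0 \<Longrightarrow> b \<in> S\<^sub>0 \<Longrightarrow> a * b \<in> S\<^sub>0"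
      "\<And>a k. a \<in> S\<^sub>0 \<Longrightarrow> a ^ k \<in> S\<^sub>0" "\<And>k. of_nat k \<in> S\<^sub>0"
      using A by (auto simp: subsemiring_def subsemiring_power subsemiring_of_nat)
    have in_S: "m \<in> S\<^sub>0" if "m \<in> M" for m using that M_subset by auto
    have in_T: "t \<in> S\<^sub>0" if "t \<in> T" for t using that T_subset by auto
    have pos: "f s > 0" if s: "s \<in> S\<^sub>0" "s \<noteq> 0" for s
    proof -
      obtain k where k: "1 \<preceq> u ^ k * s" using one_le_u_power_mult[OF s(2)] .
      have "t\<^sub>0 ^ k \<preceq> t\<^sub>0 ^ k * (u ^ k * s)" using mult_left[OF k, of "t\<^sub>0 ^ k"] by simp
      also have "\<dots> = (t\<^sub>0 * u) ^ k * s" by (simp add: power_mult_distrib mult_ac)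
      also have "\<dots> \<preceq> (of_nat n * (m * t1)) ^ k * s"
        by (rule mult_right[OF power_le_power[OF m(5)]])
      finally have "f (t\<^sub>0 ^ k) \<le> f ((of_nat n * (m * t1)) ^ k * s)"
        using m s by (intro spectrumD(6)[OF f(1)]) (auto simp: cl in_S in_T)
      also have "\<dots> = f ((of_nat n * (m * t1)) ^ k) * f s"
        using m s by (intro fs) (auto simp: cl in_S in_T)
      finally have "f t\<^sub>0 ^ k \<le> f ((of_nat n * (m * t1)) ^ k) * f s"
        using m(4) by (simp add: fs in_T)
      moreover have "f t\<^sub>0 ^ k > 0"
        using f(2) spectrumD(3)[OF f(1) in_T[OF m(4)]] by simp
      ultimately have "f s \<noteq> 0" by auto
      then show ?thesis using spectrumD(3)[OF f(1) s(1)] by simp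
    qed
    have upper: "\<exists>p\<in>S\<^sub>0. \<exists>q\<in>S\<^sub>0. f p > 0 \<and> p * s \<preceq> q" for s
    proof (cases "s = 0")
      case True
      then show ?thesis using A fs(2) by (intro bexI[of _ 1]) (auto simp: subsemiring_def)
    next
      case False
      then obtain m t1 t2 n where "m \<in> M" "m \<noteq> 0" "t1 \<in> T" "t2 \<in> T"
        "t2 * s \<preceq> of_nat n * (m * t1)" "m * t1 \<preceq> of_nat n * (t2 * s)"
        by (rule obtain_commensurable)
      then show ?thesis
        using pos T_nonzero
        by (intro bexI[of _ t2] bexI[of _ "of_nat n * (m * t1)"]) (auto simp: cl in_S in_T)
    qed
    have lower: "\<exists>p\<in>S\<^sub>0. \<exists>q\<in>S\<^sub>0. f p > 0 \<and> p \<preceq> q * s" if nz: "s \<noteq> 0" for s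
    proof -
      obtain m t1 t2 n where m: "m \<in> M" "m \<noteq> 0" "t1 \<in> T" "t2 \<in> T"
        "t2 * s \<preceq> of_nat n * (m * t1)" "m * t1 \<preceq> of_nat n * (t2 * s)"
        using obtain_commensurable[OF nz] .
      then have "m * t1 \<in> S\<^sub>0" "m * t1 \<noteq> 0" "of_nat n * t2 \<in> S\<^sub>0"
        using mult_nonzero T_nonzero by (auto simp: cl in_S in_T)
      with pos m(6) show ?thesis
        by (intro bexI[of _ "m * t1"] bexI[of _ "of_nat n * t2"]) (auto simp: mult.assoc)
    qed
    obtain g where "g \<in> spectrum UNIV (\<preceq>)" "\<forall>a\<in>S\<^sub>0. g a = f a"
      using f(1) upper lower by (rule spectrum_extension[OF preordered A])
    then show ?thesis by blast
  qed
  with m(4) show thesis by (intro that[of t\<^sub>0]) auto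
qed

text \<open>
  If the spectrum were empty, every homomorphism on \<open>S\<^sub>0\<close> would vanish at \<open>t\<^sub>0\<close>. A ratio with the
  factor \<open>t\<^sub>0\<close> in the numerator or in the denominator is then zero on the spectrum of \<open>S\<^sub>0\<close>, in the
  second case by the convention for vanishing denominators. So \<open>m * t1\<close> is below a multiple of
  \<open>t2 * t\<^sub>0\<close>, and \<open>m * t1 * t\<^sub>0\<close> is below a number, for all \<open>m\<close>, \<open>t1\<close>, \<open>t2\<close>. Used for fractions
  commensurable to \<open>1\<close> and to a large power of \<open>u\<close>, this bounds \<open>u\<close>, and then the spectrum is not
  empty.
\<close>

lemma spectrum_nonempty: "spectrum UNIV (\<preceq>) \<noteq> {}"
proof
  assume empty: "spectrum UNIV (\<preceq>) = {}"
  obtain t\<^sub>0 where t\<^sub>0: "t\<^sub>0 \<in> T" and "\<forall>f\<in>spectrum S\<^sub>0 (\<preceq>). f t\<^sub>0 \<noteq> 0 \<longrightarrow>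
       (\<exists>g\<in>spectrum UNIV (\<preceq>). \<forall>a\<in>S\<^sub>0. g a = f a)"
    using obtain_extension_test .
  with empty have vanish: "f t\<^sub>0 = 0" if "f \<in> spectrum S\<^sub>0 (\<preceq>)" for f
    using that by auto
  have vanish': "f (t * t\<^sub>0) = 0" if "f \<in> spectrum S\<^sub>0 (\<preceq>)" "t \<in> T" for f t
  proof -
    have "f (t * t\<^sub>0) = f t * f t\<^sub>0"
      using that t\<^sub>0 T_subset by (intro spectrumD(5)[OF that(1)]) auto
    then show ?thesis using vanish[OF that(1)] by simp
  qed
  have denominator: "\<exists>n. m * t1 \<preceq> of_nat n * (t2 * t\<^sub>0)"
    if "m \<in> M" "t1 \<in> T" "t2 \<in> T" for m t1 t2
  proof (intro bounded_ratio that T_mult t\<^sub>0)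
    show "bounded (ev_ratio m t1 (t2 * t\<^sub>0) ` spectrum S\<^sub>0 (\<preceq>))"
      using vanish' that by (intro boundedI[of _ 0]) (auto simp: ev_ratio_def)
  qed
  have numerator: "\<exists>n. m * (t1 * t\<^sub>0) \<preceq> of_nat n * 1" if "m \<in> M" "t1 \<in> T" for m t1
  proof (intro bounded_ratio that T_mult t\<^sub>0 T(2))
    show "bounded (ev_ratio m (t1 * t\<^sub>0) 1 ` spectrum S\<^sub>0 (\<preceq>))"
      using vanish' that by (intro boundedI[of _ 0]) (auto simp: ev_ratio_def)
  qed
  obtain m t1 \<tau> n where m: "m \<in> M" "m \<noteq> 0" "t1 \<in> T" "\<tau> \<in> T" "\<tau> * 1 \<preceq> of_nat n * (m * t1)"
    using obtain_commensurable[OF one_neq_zero] .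
  \<comment> \<open>The exponent \<open>i\<close> is fixed by \<open>\<tau>\<close> before \<open>\<sigma>\<close> is chosen as a denominator for \<open>u ^ (i + 1)\<close>;
    the one factor of \<open>u\<close> left over is the one that gets bounded.\<close>
  obtain i where i: "1 \<preceq> u ^ i * \<tau>" using one_le_u_power_mult[OF T_nonzero[OF m(4)]] .
  have "u \<noteq> 0" using one_le_u not_one_le_zero by auto
  obtain m' t1' \<sigma> n' where m': "m' \<in> M" "m' \<noteq> 0" "t1' \<in> T" "\<sigma> \<in> T"
    "\<sigma> * u ^ Suc i \<preceq> of_nat n' * (m' * t1')"
    using obtain_commensurable[OF power_nonzero[OF \<open>u \<noteq> 0\<close>, of "Suc i"]] .
  obtain a where a: "m * t1 \<preceq> of_nat a * (\<sigma> * t\<^sub>0)" using denominator[OF m(1,3) m'(4)] by blast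
  obtain b where b: "m' * (t1' * t\<^sub>0) \<preceq> of_nat b * 1" using numerator[OF m'(1,3)] by blast
  have "u \<preceq> u * (u ^ i * \<tau>)" using mult_left[OF i, of u] by simp
  also have "\<dots> = u ^ Suc i * (\<tau> * 1)" by (simp add: mult_ac)
  also have "\<dots> \<preceq> u ^ Suc i * (of_nat n * (m * t1))" by (rule mult_left[OF m(5)])
  also have "\<dots> \<preceq> u ^ Suc i * (of_nat n * (of_nat a * (\<sigma> * t\<^sub>0)))"
    by (intro mult_left a)
  also have "\<dots> = of_nat n * of_nat a * t\<^sub>0 * (\<sigma> * u ^ Suc i)" by (simp add: mult_ac)
  also have "\<dots> \<preceq> of_nat n * of_nat a * t\<^sub>0 * (of_nat n' * (m' * t1'))"
    by (rule mult_left[OF m'(5)])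
  also have "\<dots> = of_nat n * of_nat a * of_nat n' * (m' * (t1' * t\<^sub>0))" by (simp add: mult_ac)
  also have "\<dots> \<preceq> of_nat n * of_nat a * of_nat n' * (of_nat b * 1)" by (rule mult_left[OF b])
  also have "\<dots> = of_nat (n * a * n' * b)" by simp
  finally have "u \<preceq> of_nat (n * a * n' * b)" .
  then have "spectrum UNIV (\<preceq>) \<noteq> {}"
    using spectrum_nonempty_if_bounded[OF preordered] of_nat_le_iff by (metis Suc_n_not_le_n)
  with empty show False by simp
qed

text \<open>
  The ratio commensurable to \<open>y / x\<close> is expanded by \<open>t\<^sub>0\<close>. Homomorphisms on \<open>S\<^sub>0\<close> that do not extend
  vanish at \<open>t\<^sub>0\<close>, where the expanded ratio counts as zero; for the others the bound can be checked on
  the extension. The denominator \<open>t2 * t\<^sub>0\<close> remains as the common factor \<open>c\<close>.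
\<close>

lemma le_multiple_if_spectrum_le:
  assumes "x \<noteq> 0" "y \<noteq> 0" and le: "\<And>f. f \<in> spectrum UNIV (\<preceq>) \<Longrightarrow> f y \<le> f x"
  obtains c n where "c \<noteq> 0" "c * y \<preceq> of_nat n * x * c"
proof -
  obtain t\<^sub>0 where t\<^sub>0: "t\<^sub>0 \<in> T" and ext: "\<forall>f\<in>spectrum S\<^sub>0 (\<preceq>). f t\<^sub>0 \<noteq> 0 \<longrightarrow>
       (\<exists>g\<in>spectrum UNIV (\<preceq>). \<forall>a\<in>S\<^sub>0. g a = f a)"
    using obtain_extension_test .
  obtain m t1 t2 n where m: "m \<in> M" "t1 \<in> T" "t2 \<in> T"
    "t2 * y \<preceq> of_nat n * (m * t1 * x)" "m * t1 * x \<preceq> of_nat n * (t2 * y)"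
    using obtain_commensurable_ratio[OF assms(1,2)] .
  have "\<bar>ev_ratio m (t1 * t\<^sub>0) (t2 * t\<^sub>0) f\<bar> \<le> real n" if f: "f \<in> spectrum S\<^sub>0 (\<preceq>)" for f
  proof (cases "f t\<^sub>0 = 0")
    case True
    moreover have "f (t2 * t\<^sub>0) = f t2 * f t\<^sub>0"
      using m t\<^sub>0 T_subset by (intro spectrumD(5)[OF f]) auto
    ultimately show ?thesis by (simp add: ev_ratio_def)
  next
    case False
    then obtain g where g: "g \<in> spectrum UNIV (\<preceq>)" "\<forall>a\<in>S\<^sub>0. g a = f a"
      using ext f by blast
    note gs = spectrumD(4,5)[OF g(1) UNIV_I UNIV_I]
    have sub: "subsemiring (UNIV :: 'a set)" by (simp add: subsemiring_def)
    have "g (m * t1 * x) \<le> g (of_nat n * (t2 * y))" by (intro spectrumD(6)[OF g(1)] m) auto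
    then have "g m * g t1 * g x \<le> real n * (g t2 * g y)"
      by (simp add: gs spectrum_of_nat[OF sub g(1)])
    also have "\<dots> \<le> real n * (g t2 * g x)"
      using le[OF g(1)] spectrumD(3)[OF g(1)] by (intro mult_left_mono) auto
    finally have "g m * g t1 \<le> real n * g t2"
      using spectrum_pos[OF g(1) assms(1)] by (simp flip: mult.assoc)
    moreover have pos: "g t > 0" if "t \<in> T" for t
      using spectrum_pos[OF g(1)] T_nonzero[OF that] by simp
    ultimately have bound: "g m * (g t1 / g t2) \<le> real n"
      using m(3) by (simp add: field_simps)
    have "ev_ratio m (t1 * t\<^sub>0) (t2 * t\<^sub>0) f = g m * (g (t1 * t\<^sub>0) / g (t2 * t\<^sub>0))"
      using g(2) m t\<^sub>0 M_subset T_subset T_mult by (simp add: ev_ratio_def subset_iff)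
    also have "\<dots> = g m * (g t1 / g t2)" using pos[OF t\<^sub>0] by (simp add: gs)
    finally have "ev_ratio m (t1 * t\<^sub>0) (t2 * t\<^sub>0) f = g m * (g t1 / g t2)" .
    moreover have "0 \<le> g m * (g t1 / g t2)"
      using spectrumD(3)[OF g(1) UNIV_I] by simp
    ultimately show ?thesis using bound by (simp only: abs_of_nonneg)
  qed
  then have "bounded (ev_ratio m (t1 * t\<^sub>0) (t2 * t\<^sub>0) ` spectrum S\<^sub>0 (\<preceq>))"
    by (intro boundedI[of _ "real n"]) auto
  then obtain k where k: "m * (t1 * t\<^sub>0) \<preceq> of_nat k * (t2 * t\<^sub>0)"
    using bounded_ratio[OF m(1) T_mult[OF m(2) t\<^sub>0] T_mult[OF m(3) t\<^sub>0]] by blast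
  have "(t2 * t\<^sub>0) * y \<preceq> t\<^sub>0 * (of_nat n * (m * t1 * x))"
    using mult_left[OF m(4), of t\<^sub>0] by (simp add: mult_ac)
  also have "\<dots> = of_nat n * x * (m * (t1 * t\<^sub>0))" by (simp add: mult_ac)
  also have "\<dots> \<preceq> of_nat n * x * (of_nat k * (t2 * t\<^sub>0))" by (rule mult_left[OF k])
  also have "\<dots> = of_nat (n * k) * x * (t2 * t\<^sub>0)" by (simp add: mult_ac)
  finally show thesis
    using T_nonzero[OF T_mult[OF m(3) t\<^sub>0]] by (intro that[of "t2 * t\<^sub>0"])
qed

theorem asymptotically_ge_iff_spectrum:
  "asymptotically_ge (\<preceq>) u x y \<longleftrightarrow> (\<forall>f\<in>spectrum UNIV (\<preceq>). f x \<ge> f y)"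
proof
  assume le: "\<forall>f\<in>spectrum UNIV (\<preceq>). f x \<ge> f y"
  show "asymptotically_ge (\<preceq>) u x y"
  proof (cases "y = 0")
    case True
    have "y ^ n \<preceq> u ^ 0 * x ^ n" for n using True by (cases n) auto
    then show ?thesis unfolding asymptotically_ge_def by (intro exI[of _ "\<lambda>_. 0"]) simp
  next
    case False
    obtain f where f: "f \<in> spectrum UNIV (\<preceq>)" using spectrum_nonempty by blast
    \<comment> \<open>A point of the spectrum is needed here, to exclude \<open>x = 0\<close>.\<close>
    have "f y > 0" using spectrum_pos[OF f False] .
    with le f have "f x > 0" by force
    then have "x \<noteq> 0" using spectrumD(1)[OF f] by auto
    moreover obtain c n where "c \<noteq> 0" "c * y \<preceq> of_nat n * x * c"
      using le_multiple_if_spectrum_le[OF \<open>x \<noteq> 0\<close> False] le by blast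
    ultimately show ?thesis using asymptotically_ge_if_spectrum le by blast
  qed
qed (use spectrum_le_if_asymptotically_ge in blast)

end

theorem corollary1p3:
  fixes le :: "'a::comm_semiring_1 \<Rightarrow> 'a \<Rightarrow> bool"  (infix "\<preceq>" 50)
    and M T S0 :: "'a set" and u x y :: 'a
  assumes "preordered_semiring (\<preceq>)"
    and "polynomial_growth (\<preceq>)"
    and "nat_order_embedding (\<preceq>)"
    and "multiplicative_set T" and "1 \<in> T"
    and "S0 = generated_subsemiring (M \<union> T)"
    and M1': "\<And>s. s \<noteq> 0 \<Longrightarrow> \<exists>m\<in>M. \<exists>t1\<in>T. \<exists>t2\<in>T. \<exists>n::nat.
                t2 \<preceq> of_nat n * m * t1 * s \<and> m * t1 * s \<preceq> of_nat n * t2"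
    and M2': "\<And>m t1 t2. m \<in> M \<Longrightarrow> t1 \<in> T \<Longrightarrow> t2 \<in> T \<Longrightarrow>
                bounded (ev_ratio m t1 t2 ` spectrum S0 (\<preceq>)) \<Longrightarrow>
                \<exists>n::nat. m * t1 \<preceq> of_nat n * t2"
    and "power_universal (\<preceq>) u"
  shows "asymptotically_ge (\<preceq>) u x y \<longleftrightarrow> (\<forall>f\<in>spectrum UNIV (\<preceq>). f x \<ge> f y)"
proof -
  interpret commensurable_generators "(\<preceq>)" u M T S0
    by unfold_locales (fact assms)+
  show ?thesis by (rule asymptotically_ge_iff_spectrum)
qed

end
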